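(* Let $\varphi,\psi,e,k_n,u_r,k_\delta$ be as in the context, and let Assumptions 1, 2, 3 and 4 of the context hold. For any maximally prolonged solution $(x(t),y(t),\alpha(t))$, $t\in[0,t_* )$, of the closed-loop system $$\dot x=u_r\cos\alpha,\qquad \dot y=u_r\sin\alpha,\qquad \dot\alpha=\omega_d(x,y,\alpha)-k_\delta\,\delta(x,y,\alpha),$$ with $\bar r(t)=(x(t),y(t))^\top$, one of the following statements holds: 1. either $t_*=\infty$ and $\operatorname{dist}(\bar r(t),\mathcal P)\to0$ as $t\to\infty$; or 2. $\operatorname{dist}(\bar r(t),\mathcal C_0)\to0$ as $t\to t_*$.
   Context: Path and error. $\varphi\in C^2(\mathbb R^2\to\mathbb R)$; the desired path is $\mathcal P=\{(x,y):\varphi(x,y)=0\}$. $\bar n=\nabla\varphi$ (column vector), and $\mathcal C_0=\{(x,y):\nabla\varphi(x,y)=0\}$ is the set of critical points. $\psi\in C^1(\mathbb R\to\mathbb R)$ is strictly increasing with $\psi(0)=0$ and $\sup_{u\in\psi(\mathbb R)}\psi'(\psi^{-1}(u))<\infty$. The tracking error is $e(x,y)=\psi(\varphi(x,y))$. Points of $\mathbb R^2$ are written $\bar r=(x,y)^\top$; distances are Euclidean, $\operatorname{dist}(\bar r_0,A)=\inf_{\bar r\in A}|\bar r_0-\bar r|$, $\operatorname{dist}(A,B)=\inf\{|\bar r_1-\bar r_2|:\bar r_1\in A,\bar r_2\in B\}$, with $\inf\emptyset=+\infty$. Guiding vector field. $E=\begin{bmatrix}0&1\\-1&0\end{bmatrix}$,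 $\bar\tau=E\bar n$, $k_n>0$ is a constant, $\bar v(x,y)=\bar\tau(x,y)-k_n e(x,y)\bar n(x,y)$, and $\bar m_d=\bar v/|\bar v|$, defined wherever $\bar n\neq0$ (equivalently $\bar v\ne0$). Robot and controller. $u_r>0$ and $k_\delta>0$ are constants, $\bar m(\alpha)=(\cos\alpha,\sin\alpha)^\top$. For $\bar n(x,y)\ne0$: $\delta(x,y,\alpha)\in(-\pi,\pi]$ is the directed angle from $\bar m_d(x,y)$ to $\bar m(\alpha)$, i.e. $\bar m(\alpha)=(\cos\delta)\bar m_d-(\sin\delta)E\bar m_d$; and $\omega_d(x,y,\alpha)=-\bigl(u_r\,D\bar m_d(x,y)\,\bar m(\alpha)\bigr)^\top E\,\bar m_d(x,y)$, where $D\bar m_d$ is the Jacobian matrix of $\bar m_d$ (so that $\frac{d}{dt}\bar m_d(x(t),y(t))=-\omega_d E\bar m_d$ along motions with $\dot{\bar r}=u_r\bar m(\alpha)$). A solution of the closed-loop system on $[0,t_* )$ is a differentiable function $(x,y,\alpha)$ with $\bar n(x(t),y(t))\neq0$ for all $t$, satisfying the equations at every $t\in[0,t_* )$ (with the right derivative at $t=0$); it is maximally prolonged if it cannot be extended to a larger interval. Assumption 1: for every $\varkappa>0$, $\inf\{|e(\bar r)|:\operatorname{dist}(\bar r,\mathcal P)\ge\varkappa\}>0$. Assumption 2: $\operatorname{dist}(\mathcal C_0,\mathcal P)>0$. Assumption 3: for every $\varkappa>0$, $\inf\{|\bar n(\bar r)|:\operatorname{dist}(\bar r,\mathcal C_0)\ge\varkappa\}>0$.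 Assumption 4: there exist $\theta\in(0,k_\delta)$ and $C>0$ such that $|\bar n(\bar r)|\le Ce^{\theta|\bar r|}$ for all $\bar r$ with $|\bar r|$ sufficiently large (here $e^{\theta|\bar r|}$ is the exponential function). *)

theory Defs
  imports "HOL-Analysis.Analysis"
begin

(* infdist and setdist yield 0 for empty sets; here the infimum over the empty set is +\<infinity>,
   hence the ereal-valued distances. *)

definition edist_to_set :: "'a::metric_space \<Rightarrow> 'a set \<Rightarrow> ereal" where
  "edist_to_set r A = (INF s\<in>A. ereal (dist r s))"

definition edist_sets :: "'a::metric_space set \<Rightarrow> 'a set \<Rightarrow> ereal" where
  "edist_sets A B = (INF (r, s)\<in>A \<times> B. ereal (dist r s))"

definition grad :: "('a::real_inner \<Rightarrow> real) \<Rightarrow> 'a \<Rightarrow> 'a" where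
  "grad f r = (THE D. GDERIV f r :> D)"

lemma grad_eqI:
  assumes "GDERIV f r :> D"
  shows "grad f r = D"
  unfolding grad_def
proof (rule the_equality)
  fix D' assume "GDERIV f r :> D'"
  with assms have "(\<lambda>h. h \<bullet> D') = (\<lambda>h. h \<bullet> D)"
    unfolding gderiv_def by (rule has_derivative_unique[rotated])
  then have "h \<bullet> (D' - D) = 0" for h
    by (auto simp: inner_diff_right dest: fun_cong)
  from this[of "D' - D"] show "D' = D" by simp
qed (fact assms)

lemma GDERIV_grad:
  fixes f :: "'a::euclidean_space \<Rightarrow> real"
  assumes "f differentiable at r"
  shows "GDERIV f r :> grad f r"
proof -
  from assms obtain f' where f': "(f has_derivative f') (at r)"
    by (auto simp: differentiable_def)
  then have lin: "linear f'" by (rule has_derivative_linear)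
  have "f' h = h \<bullet> adjoint f' 1" for h
    using adjoint_works[OF lin, of h 1] by simp
  then have "f' = (\<lambda>h. h \<bullet> adjoint f' 1)" by (rule ext)
  with f' have "GDERIV f r :> adjoint f' 1"
    by (simp add: gderiv_def)
  then show ?thesis using grad_eqI by metis
qed

definition C2_scalar :: "(real^'n \<Rightarrow> real) \<Rightarrow> bool" where
  "C2_scalar f \<longleftrightarrow>
     (\<forall>r. f differentiable at r) \<and> (\<forall>r. grad f differentiable at r) \<and>
     continuous_on UNIV (\<lambda>r. jacobian (grad f) (at r))"

definition path_set :: "(real^2 \<Rightarrow> real) \<Rightarrow> (real^2) set" where
  "path_set \<phi> = {r. \<phi> r = 0}"

definition critical_set :: "(real^2 \<Rightarrow> real) \<Rightarrow> (real^2) set" where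
  "critical_set \<phi> = {r. grad \<phi> r = 0}"

definition tracking_error :: "(real^2 \<Rightarrow> real) \<Rightarrow> (real \<Rightarrow> real) \<Rightarrow> real^2 \<Rightarrow> real" where
  "tracking_error \<phi> \<psi> r = \<psi> (\<phi> r)"

definition E_rot :: "real^2^2" where
  "E_rot = vector [vector [0, 1], vector [- 1, 0]]"

definition tangent :: "(real^2 \<Rightarrow> real) \<Rightarrow> real^2 \<Rightarrow> real^2" where
  "tangent \<phi> r = E_rot *v grad \<phi> r"

definition guiding_field ::
    "(real^2 \<Rightarrow> real) \<Rightarrow> (real \<Rightarrow> real) \<Rightarrow> real \<Rightarrow> real^2 \<Rightarrow> real^2" where
  "guiding_field \<phi> \<psi> k\<^sub>n r =
     tangent \<phi> r - (k\<^sub>n * tracking_error \<phi> \<psi> r) *\<^sub>R grad \<phi> r"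

definition desired_dir ::
    "(real^2 \<Rightarrow> real) \<Rightarrow> (real \<Rightarrow> real) \<Rightarrow> real \<Rightarrow> real^2 \<Rightarrow> real^2" where
  "desired_dir \<phi> \<psi> k\<^sub>n r = guiding_field \<phi> \<psi> k\<^sub>n r /\<^sub>R norm (guiding_field \<phi> \<psi> k\<^sub>n r)"

definition heading :: "real \<Rightarrow> real^2" where
  "heading \<alpha> = vector [cos \<alpha>, sin \<alpha>]"

definition directed_angle :: "real^2 \<Rightarrow> real^2 \<Rightarrow> real" where
  "directed_angle m m' =
     (THE d. - pi < d \<and> d \<le> pi \<and> m' = cos d *\<^sub>R m - sin d *\<^sub>R (E_rot *v m))"

lemma directed_angle_ex1:
  assumes m: "norm m = 1" and m': "norm m' = 1"
  shows "\<exists>!d. - pi < d \<and> d \<le> pi \<and> m' = cos d *\<^sub>R m - sin d *\<^sub>R (E_rot *v m)"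
proof -
  define z where "z = Complex (m$1 * m'$1 + m$2 * m'$2) (m$1 * m'$2 - m$2 * m'$1)"
  have 1: "m$1 * m$1 + m$2 * m$2 = 1" "m'$1 * m'$1 + m'$2 * m'$2 = 1"
    using m m' by (simp_all add: norm_eq_1 inner_vec_def sum_2)
  have E: "(E_rot *v m)$1 = m$2" "(E_rot *v m)$2 = - m$1"
    by (simp_all add: E_rot_def matrix_vector_mult_def sum_2)
  have sq: "(m$1 * m'$1 + m$2 * m'$2)\<^sup>2 + (m$1 * m'$2 - m$2 * m'$1)\<^sup>2 = 1"
  proof -
    have "(m$1 * m'$1 + m$2 * m'$2)\<^sup>2 + (m$1 * m'$2 - m$2 * m'$1)\<^sup>2
        = (m$1 * m$1 + m$2 * m$2) * (m'$1 * m'$1 + m'$2 * m'$2)"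
      by (simp add: power2_eq_square algebra_simps)
    then show ?thesis by (simp add: 1)
  qed
  then have z1: "cmod z = 1" by (simp add: z_def cmod_def)
  have iff: "m' = cos d *\<^sub>R m - sin d *\<^sub>R (E_rot *v m) \<longleftrightarrow> cis d = z" for d
  proof -
    have "m' = cos d *\<^sub>R m - sin d *\<^sub>R (E_rot *v m) \<longleftrightarrow>
      m'$1 = cos d * m$1 - sin d * m$2 \<and> m'$2 = cos d * m$2 + sin d * m$1"
      by (simp add: vec_eq_iff forall_2 E)
    also have "\<dots> \<longleftrightarrow> cos d = m$1 * m'$1 + m$2 * m'$2 \<and> sin d = m$1 * m'$2 - m$2 * m'$1"
      using 1(1) by algebra
    also have "\<dots> \<longleftrightarrow> cis d = z" by (simp add: z_def complex_eq_iff)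
    finally show ?thesis .
  qed
  have z: "z \<noteq> 0" "sgn z = z" using z1 by (auto simp: sgn_eq)
  show ?thesis
  proof (rule ex1I[of _ "Arg z"])
    show "- pi < Arg z \<and> Arg z \<le> pi \<and> m' = cos (Arg z) *\<^sub>R m - sin (Arg z) *\<^sub>R (E_rot *v m)"
      using cis_Arg[OF z(1)] z Arg_bounded[of z] by (simp add: iff)
  next
    fix d assume "- pi < d \<and> d \<le> pi \<and> m' = cos d *\<^sub>R m - sin d *\<^sub>R (E_rot *v m)"
    then show "d = Arg z"
      using cis_Arg_unique[of z d] z by (auto simp: iff)
  qed
qed

definition heading_error ::
    "(real^2 \<Rightarrow> real) \<Rightarrow> (real \<Rightarrow> real) \<Rightarrow> real \<Rightarrow> real^2 \<Rightarrow> real \<Rightarrow> real" where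
  "heading_error \<phi> \<psi> k\<^sub>n r \<alpha> = directed_angle (desired_dir \<phi> \<psi> k\<^sub>n r) (heading \<alpha>)"

definition desired_rate ::
    "(real^2 \<Rightarrow> real) \<Rightarrow> (real \<Rightarrow> real) \<Rightarrow> real \<Rightarrow> real \<Rightarrow> real^2 \<Rightarrow> real \<Rightarrow> real" where
  "desired_rate \<phi> \<psi> k\<^sub>n u\<^sub>r r \<alpha> =
     - ((u\<^sub>r *\<^sub>R (jacobian (desired_dir \<phi> \<psi> k\<^sub>n) (at r) *v heading \<alpha>))
        \<bullet> (E_rot *v desired_dir \<phi> \<psi> k\<^sub>n r))"

definition time_dom :: "ereal \<Rightarrow> real set" where
  "time_dom T = {t. 0 \<le> t \<and> ereal t < T}"

definition pos :: "(real \<Rightarrow> real) \<Rightarrow> (real \<Rightarrow> real) \<Rightarrow> real \<Rightarrow> real^2" where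
  "pos x y t = vector [x t, y t]"

(* The derivative within time_dom T is one-sided at 0 and two-sided at every t > 0. *)
definition closed_loop_solution ::
    "(real^2 \<Rightarrow> real) \<Rightarrow> (real \<Rightarrow> real) \<Rightarrow> real \<Rightarrow> real \<Rightarrow> real \<Rightarrow>
     ereal \<Rightarrow> (real \<Rightarrow> real) \<Rightarrow> (real \<Rightarrow> real) \<Rightarrow> (real \<Rightarrow> real) \<Rightarrow> bool" where
  "closed_loop_solution \<phi> \<psi> k\<^sub>n u\<^sub>r k\<^sub>\<delta> T x y \<alpha> \<longleftrightarrow>
     0 < T \<and>
     (\<forall>t\<in>time_dom T.
        grad \<phi> (pos x y t) \<noteq> 0 \<and>
        (x has_real_derivative u\<^sub>r * cos (\<alpha> t)) (at t within time_dom T) \<and>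
        (y has_real_derivative u\<^sub>r * sin (\<alpha> t)) (at t within time_dom T) \<and>
        (\<alpha> has_real_derivative
           desired_rate \<phi> \<psi> k\<^sub>n u\<^sub>r (pos x y t) (\<alpha> t)
             - k\<^sub>\<delta> * heading_error \<phi> \<psi> k\<^sub>n (pos x y t) (\<alpha> t)) (at t within time_dom T))"

definition maximal_closed_loop_solution ::
    "(real^2 \<Rightarrow> real) \<Rightarrow> (real \<Rightarrow> real) \<Rightarrow> real \<Rightarrow> real \<Rightarrow> real \<Rightarrow>
     ereal \<Rightarrow> (real \<Rightarrow> real) \<Rightarrow> (real \<Rightarrow> real) \<Rightarrow> (real \<Rightarrow> real) \<Rightarrow> bool" where
  "maximal_closed_loop_solution \<phi> \<psi> k\<^sub>n u\<^sub>r k\<^sub>\<delta> T x y \<alpha> \<longleftrightarrow>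
     closed_loop_solution \<phi> \<psi> k\<^sub>n u\<^sub>r k\<^sub>\<delta> T x y \<alpha> \<and>
     \<not> (\<exists>T' x' y' \<alpha>'.
          T < T' \<and> closed_loop_solution \<phi> \<psi> k\<^sub>n u\<^sub>r k\<^sub>\<delta> T' x' y' \<alpha>' \<and>
          (\<forall>t\<in>time_dom T. x' t = x t \<and> y' t = y t \<and> \<alpha>' t = \<alpha> t))"

definition end_time :: "ereal \<Rightarrow> real filter" where
  "end_time T = (if T = \<infinity> then at_top else at_left (real_of_ereal T))"

end

theory Submission
  imports Defs
begin

text \<open>
  Along a solution the heading error obeys \<open>\<delta>' = - k\<^sub>\<delta> \<delta>\<close>, so it decays exponentially, while
  \<open>d/dt \<phi>(r) = u\<^sub>r |n| (sin \<delta> - k\<^sub>n e cos \<delta>) / sqrt (1 + (k\<^sub>n e)\<^sup>2)\<close>. Once \<open>\<delta>\<close> is small, \<open>|\<phi>|\<close> therefore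
  decreases whenever \<open>|e| \<ge> \<epsilon>\<close>. If \<open>T = \<infinity>\<close> and \<open>r\<close> does not approach the critical set, then, since the speed
  is bounded, \<open>|n|\<close> is bounded below on infinitely many time intervals of a fixed length, which forces \<open>|e|\<close>
  below \<open>\<epsilon>\<close>.

  If \<open>T < \<infinity>\<close>, then \<open>r\<close> has a limit \<open>p\<close>. Were \<open>p\<close> not critical, the solution could be prolonged:
  the closed-loop field is merely continuous, but prescribing \<open>\<delta>\<close> as the known exponential turns the position
  equation into \<open>r' = u\<^sub>r (cos \<delta>(t) m(r) - sin \<delta>(t) E m(r))\<close>, which is locally Lipschitz in \<open>r\<close>,
  and \<open>\<alpha>\<close> is then recovered by integration.
\<close>

section \<open>Ordinary differential equations\<close>

text \<open>On a short interval the Picard operator halves sup-distances, so Banach's theorem on the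
  complete type \<open>bcontfun\<close> yields a fixed point. Composing \<open>F\<close> with the
  nearest-point projection \<open>q\<close> lets the operator act on every bounded continuous
  function; the fixed point stays in the ball, where \<open>q\<close> is the identity.\<close>

lemma picard_lindeloef_local:
  fixes F :: "real \<Rightarrow> 'a::euclidean_space \<Rightarrow> 'a"
  assumes ab: "a < b" and \<rho>: "0 < \<rho>"
    and cont: "continuous_on ({a..b} \<times> cball p \<rho>) (\<lambda>(t, r). F t r)"
    and lip: "\<And>t r s. t \<in> {a..b} \<Longrightarrow> r \<in> cball p \<rho> \<Longrightarrow> s \<in> cball p \<rho> \<Longrightarrow>
      norm (F t r - F t s) \<le> L * norm (r - s)"
  obtains c r where "a < c" "c \<le> b" "r a = p" "\<And>t. t \<in> {a..c} \<Longrightarrow> r t \<in> cball p \<rho>"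
    "\<And>t. t \<in> {a..c} \<Longrightarrow> (r has_vector_derivative F t (r t)) (at t within {a..c})"
proof -
  define K where "K = cball p \<rho>"
  define q where "q = closest_point K"
  have K: "convex K" "closed K" "K \<noteq> {}" "p \<in> K" "compact K"
    using \<rho> by (auto simp: K_def)
  have qK: "q r \<in> K" for r
    unfolding q_def using K by (intro closest_point_in_set)
  have qlip: "norm (q r - q s) \<le> norm (r - s)" for r s
    using closest_point_lipschitz[OF K(1-3), of r s] by (simp add: q_def dist_norm)
  have qid: "q r = r" if "r \<in> K" for r
    using that by (simp add: q_def closest_point_self)
  have qcont: "continuous_on A q" for A
    unfolding q_def using K by (intro continuous_on_closest_point) auto
  have cont': "continuous_on ({a..b} \<times> K) (\<lambda>(t, r). F t r)"
    using cont by (simp add: K_def)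
  have "compact ((\<lambda>(t, r). F t r) ` ({a..b} \<times> K))"
    by (intro compact_continuous_image cont' compact_Times K) auto
  then obtain B where B: "\<And>z. z \<in> (\<lambda>(t, r). F t r) ` ({a..b} \<times> K) \<Longrightarrow> norm z \<le> B"
    using compact_imp_bounded bounded_iff by metis
  have FB: "norm (F t r) \<le> \<bar>B\<bar>" if "t \<in> {a..b}" "r \<in> K" for t r
    using B[of "F t r"] that by force
  \<comment> \<open>The three bounds keep \<open>a + h\<close> within the interval, the displacement
    within \<open>\<rho>\<close> and the contraction factor at most 1/2; adding 1 keeps the
    denominators positive.\<close>
  define h where "h = Min {b - a, \<rho> / (\<bar>B\<bar> + 1), 1 / (2 * (\<bar>L\<bar> + 1))}"
  have "h \<le> b - a" "h \<le> \<rho> / (\<bar>B\<bar> + 1)" "h \<le> 1 / (2 * (\<bar>L\<bar> + 1))" "0 < h"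
    using ab \<rho> by (auto simp: h_def)
  then have h: "0 < h" "a + h \<le> b" "\<bar>B\<bar> * h \<le> \<rho>" "\<bar>L\<bar> * h \<le> 1 / 2"
    by (auto simp: field_simps)
  define c where "c = a + h"
  have c: "a < c" "c \<le> b" using h by (auto simp: c_def)
  \<comment> \<open>Clamping the time to \<open>{a..c}\<close> extends \<open>J u\<close> by
    constants to the whole line, as an element of \<open>bcontfun\<close> has to be defined
    there.\<close>
  define T where "T t = max a (min t c)" for t
  have T: "T t \<in> {a..c}" "T t \<in> {a..b}" for t using c by (auto simp: T_def)
  define G where "G (u::real \<Rightarrow>\<^sub>C 'a) s = F s (q (u s))" for u s
  have Gcont: "continuous_on {a..c} (G u)" for u
  proof -
    have "continuous_on {a..c} ((\<lambda>(t, r). F t r) \<circ> (\<lambda>s. (s, q (apply_bcontfun u s))))"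
      by (intro continuous_on_compose continuous_on_Pair continuous_on_id
          continuous_on_compose2[OF qcont] continuous_on_subset[OF cont'])
        (use c qK in auto)
    then show ?thesis by (simp add: G_def[abs_def] o_def)
  qed
  define J where "J u t = p + integral {a..t} (G u)" for u t
  have Gint: "G u integrable_on {a..t}" if "t \<in> {a..c}" for u t
    using that by (intro integrable_continuous_real continuous_on_subset[OF Gcont]) auto
  have Jcont: "continuous_on {a..c} (J u)" for u
    unfolding J_def by (intro continuous_intros indefinite_integral_continuous_1 Gint) (use c in auto)
  have Jbound: "norm (J u t - p) \<le> \<rho>" if "t \<in> {a..c}" for u t
  proof -
    have "norm (integral {a..t} (G u)) \<le> \<bar>B\<bar> * (t - a)"
      by (intro integral_bound continuous_on_subset[OF Gcont] FB[folded G_def])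
        (use that c qK in \<open>auto simp: G_def intro!: FB\<close>)
    also have "\<dots> \<le> \<bar>B\<bar> * h"
      using that by (intro mult_left_mono) (auto simp: c_def)
    finally show ?thesis using h by (simp add: J_def)
  qed
  have JT: "(\<lambda>t. J u (T t)) \<in> bcontfun" for u
  proof (rule bcontfun_normI)
    show "continuous_on UNIV (\<lambda>t. J u (T t))"
      by (rule continuous_on_compose2[OF Jcont]) (use T in \<open>auto simp: T_def intro!: continuous_intros\<close>)
    show "norm (J u (T t)) \<le> \<rho> + norm p" for t
      using Jbound[OF T(1), of u t] norm_triangle_ineq2[of "J u (T t)" p] by linarith
  qed
  define \<Phi> where "\<Phi> u = Bcontfun (\<lambda>t. J u (T t))" for u
  have \<Phi>: "apply_bcontfun (\<Phi> u) t = J u (T t)" for u t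
    using JT[of u] by (simp add: \<Phi>_def Bcontfun_inverse)
  have "dist (\<Phi> u) (\<Phi> v) \<le> 1 / 2 * dist u v" for u v
  proof (rule dist_bound)
    fix t
    let ?t = "T t"
    have "J u ?t - J v ?t = integral {a..?t} (\<lambda>s. G u s - G v s)"
      using Gint[OF T(1)] by (simp add: J_def integral_diff)
    also have "norm \<dots> \<le> (\<bar>L\<bar> * dist u v) * (?t - a)"
    proof (rule integral_bound)
      show "continuous_on {a..?t} (\<lambda>s. G u s - G v s)"
        by (intro continuous_intros continuous_on_subset[OF Gcont]) (use T[of t] in auto)
      fix s assume s: "s \<in> {a..?t}"
      have "norm (G u s - G v s) \<le> L * norm (q (u s) - q (v s))"
        unfolding G_def by (rule lip) (use s T[of t] qK in \<open>auto simp: K_def\<close>)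
      also have "\<dots> \<le> \<bar>L\<bar> * norm (q (u s) - q (v s))"
        by (intro mult_right_mono) auto
      also have "\<dots> \<le> \<bar>L\<bar> * dist u v"
        using qlip[of "u s" "v s"] dist_bounded[of u s v]
        by (intro mult_left_mono) (auto simp: dist_norm)
      finally show "norm (G u s - G v s) \<le> \<bar>L\<bar> * dist u v" .
    qed (use T[of t] in auto)
    also have "\<dots> \<le> (\<bar>L\<bar> * dist u v) * h"
      using T[of t] by (intro mult_left_mono) (auto simp: c_def)
    also have "\<dots> \<le> 1 / 2 * dist u v"
      using mult_right_mono[OF h(4), of "dist u v"] by (simp add: mult_ac)
    finally show "dist (\<Phi> u t) (\<Phi> v t) \<le> 1 / 2 * dist u v"
      by (simp add: \<Phi> dist_norm)
  qed
  then obtain u where u: "\<Phi> u = u"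
    using banach_fix_type[of "1 / 2" \<Phi>] by auto
  have uJ: "u t = J u t" if "t \<in> {a..c}" for t
    using \<Phi>[of u t] that by (simp add: u T_def)
  have uK: "u t \<in> K" if "t \<in> {a..c}" for t
    using Jbound[OF that, of u] uJ[OF that] by (simp add: K_def dist_norm norm_minus_commute)
  show thesis
  proof (rule that[of c u])
    show "u a = p" using uJ[of a] c by (simp add: J_def)
    show "u t \<in> cball p \<rho>" if "t \<in> {a..c}" for t using uK[OF that] by (simp add: K_def)
    fix t assume t: "t \<in> {a..c}"
    have "(J u has_vector_derivative G u t) (at t within {a..c})"
      unfolding J_def using integral_has_vector_derivative[OF Gcont t, of u]
      by (auto intro!: derivative_eq_intros)
    then show "(u has_vector_derivative F t (u t)) (at t within {a..c})"
      using has_vector_derivative_transform[OF t uJ] qid[OF uK[OF t]] by (simp add: G_def)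
  qed (use c in auto)
qed

text \<open>A bounded derivative makes \<open>f\<close> Lipschitz, hence uniformly continuous, and
  such a function extends continuously to the closure of the interval.\<close>

lemma left_limit_of_bounded_derivative:
  fixes f f' :: "real \<Rightarrow> real"
  assumes ab: "a < b" and der: "\<And>t. a < t \<Longrightarrow> t < b \<Longrightarrow> (f has_real_derivative f' t) (at t)"
    and bound: "\<And>t. a < t \<Longrightarrow> t < b \<Longrightarrow> \<bar>f' t\<bar> \<le> B"
  obtains l where "(f \<longlongrightarrow> l) (at_left b)"
proof -
  have "\<bar>B\<bar>-lipschitz_on {a<..<b} f"
  proof (rule lipschitz_onI)
    fix s t assume st: "s \<in> {a<..<b}" "t \<in> {a<..<b}"
    have "norm (f s - f t) \<le> \<bar>B\<bar> * norm (s - t)"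
    proof (rule field_differentiable_bound[of "{a<..<b}" f f'])
      fix z assume "z \<in> {a<..<b}"
      then show "(f has_field_derivative f' z) (at z within {a<..<b})" "norm (f' z) \<le> \<bar>B\<bar>"
        using der[of z] bound[of z] by (auto intro: has_field_derivative_at_within)
    qed (use st in auto)
    then show "dist (f s) (f t) \<le> \<bar>B\<bar> * dist s t" by (simp add: dist_norm)
  qed auto
  then have "uniformly_continuous_on {a<..<b} f"
    by (rule lipschitz_on_uniformly_continuous)
  then obtain l where l: "(f \<longlongrightarrow> l) (at b within {a<..<b})"
    using uniformly_continuous_on_extension_at_closure[of "{a<..<b}" f b] ab by auto
  have "at b within {a<..<b} = at_left b"
    using ab by (intro at_within_nhd[of b "{a<..}"]) auto
  with l show thesis by (intro that) simp
qed

text \<open>From the left, L'Hospital's rule turns the limit of \<open>f'\<close> into the limit of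
  the difference quotients; from the right, the quotients are those of \<open>g\<close>. This joins
  an old solution and its continuation at the time \<open>b\<close>.\<close>

lemma has_real_derivative_glue:
  fixes f f' g :: "real \<Rightarrow> real"
  assumes abc: "a < b" "b < c"
    and der: "\<And>t. a < t \<Longrightarrow> t < b \<Longrightarrow> (f has_real_derivative f' t) (at t)"
    and f: "(f \<longlongrightarrow> g b) (at_left b)" and f': "(f' \<longlongrightarrow> D) (at_left b)"
    and g: "(g has_real_derivative D) (at b within {b..c})"
  shows "((\<lambda>t. if t < b then f t else g t) has_real_derivative D) (at b)"
proof -
  let ?h = "\<lambda>t. if t < b then f t else g t"
  have "((\<lambda>t. (f t - g b) / (t - b)) \<longlongrightarrow> D) (at_left b)"
  proof (rule lhopital_left[where f'=f' and g'="\<lambda>_. 1"])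
    show "((\<lambda>t. f t - g b) \<longlongrightarrow> 0) (at_left b)"
      using tendsto_diff[OF f tendsto_const[of "g b"]] by simp
    show "((\<lambda>t. t - b) \<longlongrightarrow> 0) (at_left b)"
      by (auto intro!: tendsto_eq_intros)
    show "\<forall>\<^sub>F t in at_left b. t - b \<noteq> 0"
      by (auto simp: eventually_at_left[OF abc(1)] intro: exI[of _ a] abc)
    show "\<forall>\<^sub>F t in at_left b. ((\<lambda>t. f t - g b) has_real_derivative f' t) (at t)"
      unfolding eventually_at_left[OF abc(1)] using abc der
      by (auto intro!: exI[of _ a] derivative_eq_intros)
    show "\<forall>\<^sub>F t in at_left b. ((\<lambda>t. t - b) has_real_derivative 1) (at t)"
      by (auto intro!: always_eventually derivative_eq_intros)
  qed (use f' in auto)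
  then have left: "((\<lambda>t. (?h t - ?h b) / (t - b)) \<longlongrightarrow> D) (at_left b)"
    by (rule tendsto_cong[THEN iffD1, rotated])
      (auto simp: eventually_at_left[OF abc(1)] intro: exI[of _ a] abc)
  have "at b within {b..c} = at_right b"
    using abc by (metis at_within_Icc_at_right)
  then have "((\<lambda>t. (g t - g b) / (t - b)) \<longlongrightarrow> D) (at_right b)"
    using g by (simp add: has_field_derivative_iff)
  then have "((\<lambda>t. (?h t - ?h b) / (t - b)) \<longlongrightarrow> D) (at_right b)"
    by (rule tendsto_cong[THEN iffD1, rotated])
      (auto simp: eventually_at_right[OF abc(2)] intro: exI[of _ c] abc)
  with left show ?thesis
    by (simp add: has_field_derivative_iff filterlim_at_split)
qed

text \<open>Compactness of ball times unit sphere bounds \<open>M r h\<close>, homogeneity turns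
  this into a bound on the operator norm, and the mean value inequality applies on the convex ball.
  Continuity jointly in point and direction avoids a topology on linear maps.\<close>

lemma C1_imp_lipschitz_on_cball:
  fixes G :: "'a::euclidean_space \<Rightarrow> 'b::euclidean_space"
  assumes der: "\<And>r. r \<in> cball p \<rho> \<Longrightarrow> (G has_derivative M r) (at r)"
    and cont: "continuous_on (cball p \<rho> \<times> sphere 0 1) (\<lambda>(r, h). M r h)"
  obtains L where "\<And>r s. r \<in> cball p \<rho> \<Longrightarrow> s \<in> cball p \<rho> \<Longrightarrow> norm (G r - G s) \<le> L * norm (r - s)"
proof -
  have "compact ((\<lambda>(r, h). M r h) ` (cball p \<rho> \<times> sphere 0 1))"
    by (intro compact_continuous_image cont compact_Times) auto
  then obtain B where B: "\<And>z. z \<in> (\<lambda>(r, h). M r h) ` (cball p \<rho> \<times> sphere 0 1) \<Longrightarrow> norm z \<le> B"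
    using compact_imp_bounded bounded_iff by metis
  have on: "onorm (M r) \<le> \<bar>B\<bar>" if r: "r \<in> cball p \<rho>" for r
  proof (rule onorm_bound)
    fix h
    have lin: "linear (M r)" using der[OF r] by (rule has_derivative_linear)
    show "norm (M r h) \<le> \<bar>B\<bar> * norm h"
    proof (cases "h = 0")
      case True then show ?thesis using linear_0[OF lin] by simp
    next
      case False
      have "norm (M r (h /\<^sub>R norm h)) \<le> B"
        using B[of "M r (h /\<^sub>R norm h)"] r False by force
      then have "norm (M r h) / norm h \<le> \<bar>B\<bar>"
        using False by (simp add: linear_scale[OF lin] divide_inverse mult.commute)
      with False show ?thesis by (simp add: field_simps)
    qed
  qed simp
  show thesis
    by (rule that[of "\<bar>B\<bar>"], rule differentiable_bound[of "cball p \<rho>" G M])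
      (auto intro!: has_derivative_at_withinI[OF der] on)
qed

section \<open>Rotations of the plane\<close>

lemma E_rot_component [simp]: "(E_rot *v w) $ 1 = w $ 2" "(E_rot *v w) $ 2 = - (w $ 1)"
  by (simp_all add: E_rot_def matrix_vector_mult_def sum_2)

lemma inner_real2: "(v::real^2) \<bullet> w = v $ 1 * w $ 1 + v $ 2 * w $ 2"
  by (simp add: inner_vec_def sum_2)

lemma E_rot_E_rot [simp]: "E_rot *v (E_rot *v w) = - w"
  by (simp add: vec_eq_iff forall_2)

lemma E_rot_linear [simp]: "E_rot *v (- w) = - (E_rot *v w)" "E_rot *v (a *\<^sub>R w) = a *\<^sub>R (E_rot *v w)"
  by (simp_all add: vec_eq_iff forall_2)

lemma inner_E_rot [simp]: "(E_rot *v v) \<bullet> (E_rot *v w) = v \<bullet> w" "v \<bullet> (E_rot *v v) = 0" "(E_rot *v v) \<bullet> v = 0"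
  by (simp_all add: inner_real2)

lemma inner_E_rot_right: "m' \<bullet> (E_rot *v w) = - ((E_rot *v m') \<bullet> w)"
  by (simp add: inner_real2)

lemma norm_E_rot [simp]: "norm (E_rot *v v) = norm v"
  by (simp add: norm_eq_sqrt_inner)

lemma heading_component [simp]: "heading a $ 1 = cos a" "heading a $ 2 = sin a"
  by (simp_all add: heading_def)

lemma norm_heading [simp]: "norm (heading a) = 1"
  by (simp add: norm_eq_1 inner_real2 flip: power2_eq_square)

lemma continuous_on_matrix_vector_mult [continuous_intros]:
  fixes A :: "'a::topological_space \<Rightarrow> real^'n^'m"
  assumes "continuous_on S A" "continuous_on S f"
  shows "continuous_on S (\<lambda>z. A z *v f z)"
  unfolding matrix_vector_mult_def
  by (intro continuous_on_vec_lambda continuous_intros assms)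

lemma continuous_on_heading [continuous_intros]:
  fixes f :: "'a::t2_space \<Rightarrow> real"
  assumes "continuous_on A f"
  shows "continuous_on A (\<lambda>t. heading (f t))"
proof -
  have heading_eq: "heading a = cos a *\<^sub>R axis 1 1 + sin a *\<^sub>R axis 2 1" for a
    by (simp add: vec_eq_iff forall_2 axis_def)
  show ?thesis
    unfolding heading_eq by (intro continuous_intros assms)
qed

lemma directed_angle_props:
  assumes "norm m = 1" "norm m' = 1"
  shows "- pi < directed_angle m m'" "directed_angle m m' \<le> pi"
    "m' = cos (directed_angle m m') *\<^sub>R m - sin (directed_angle m m') *\<^sub>R (E_rot *v m)"
  using theI'[OF directed_angle_ex1[OF assms]] unfolding directed_angle_def by blast+

lemma directed_angle_eqI:
  assumes "norm m = 1" "norm m' = 1" "- pi < d" "d \<le> pi"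
    "m' = cos d *\<^sub>R m - sin d *\<^sub>R (E_rot *v m)"
  shows "directed_angle m m' = d"
  unfolding directed_angle_def using assms
  by (intro the1_equality[OF directed_angle_ex1[OF assms(1,2)]]) auto

lemma has_vector_derivative_real2_iff:
  fixes f :: "real \<Rightarrow> real^2"
  shows "(f has_vector_derivative D) (at t within S) \<longleftrightarrow>
    ((\<lambda>t. f t $ 1) has_real_derivative D $ 1) (at t within S) \<and>
    ((\<lambda>t. f t $ 2) has_real_derivative D $ 2) (at t within S)"
  unfolding has_vector_derivative_def has_field_derivative_def
  by (subst has_derivative_componentwise_within)
     (simp add: Basis_vec_def inner_axis UNIV_2 mult.commute[of _ "D $ _"] conj_commute)

section \<open>The guiding vector field\<close>

locale guided_path =
  fixes \<phi> :: "real^2 \<Rightarrow> real" and \<psi> :: "real \<Rightarrow> real" and k :: real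
  assumes C2: "C2_scalar \<phi>" and \<psi>C1: "\<psi> C1_differentiable_on UNIV"
    and \<psi>_mono: "strict_mono \<psi>" and \<psi>_0: "\<psi> 0 = 0" and k_pos: "k > 0"
begin

abbreviation "n \<equiv> grad \<phi>"
abbreviation "e \<equiv> tracking_error \<phi> \<psi>"
abbreviation "v \<equiv> guiding_field \<phi> \<psi> k"
abbreviation "m \<equiv> desired_dir \<phi> \<psi> k"
abbreviation "regular \<equiv> {r. n r \<noteq> 0}"

lemma \<phi>_has_derivative: "(\<phi> has_derivative (\<lambda>h. n r \<bullet> h)) (at r)"
  using GDERIV_grad[of \<phi> r] C2 by (auto simp: C2_scalar_def gderiv_def inner_commute)

lemma n_has_derivative: "(n has_derivative (\<lambda>h. jacobian n (at r) *v h)) (at r)"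
  using C2 by (auto simp: C2_scalar_def simp flip: jacobian_works)

lemma continuous_on_jacobian_n: "continuous_on A f \<Longrightarrow> continuous_on A (\<lambda>z. jacobian n (at (f z)))"
  using C2 continuous_on_compose2[of UNIV "\<lambda>r. jacobian n (at r)" A f] by (auto simp: C2_scalar_def)

lemma continuous_on_n: "continuous_on A f \<Longrightarrow> continuous_on A (\<lambda>z. n (f z))"
  by (rule continuous_on_compose2[of UNIV n A f])
    (auto intro!: continuous_at_imp_continuous_on has_derivative_continuous[OF n_has_derivative])

lemma continuous_on_\<phi>: "continuous_on A f \<Longrightarrow> continuous_on A (\<lambda>z. \<phi> (f z))"
  by (rule continuous_on_compose2[of UNIV \<phi> A f])
    (auto intro!: continuous_at_imp_continuous_on has_derivative_continuous[OF \<phi>_has_derivative])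

lemma \<psi>_has_derivative: "(\<psi> has_real_derivative deriv \<psi> z) (at z)"
  using \<psi>C1 by (auto simp: C1_differentiable_on_eq real_differentiable_def field_differentiable_def dest: DERIV_imp_deriv spec[of _ z])

lemma continuous_on_\<psi>: "continuous_on A f \<Longrightarrow> continuous_on A (\<lambda>z. \<psi> (f z))"
  by (rule continuous_on_compose2[of UNIV \<psi> A f])
    (auto intro!: continuous_at_imp_continuous_on DERIV_isCont[OF \<psi>_has_derivative])

lemma continuous_on_deriv_\<psi>: "continuous_on A f \<Longrightarrow> continuous_on A (\<lambda>z. deriv \<psi> (f z))"
proof (rule continuous_on_compose2[of UNIV "deriv \<psi>" A f])
  have "vector_derivative \<psi> (at z) = deriv \<psi> z" for z
    using \<psi>_has_derivative by (intro vector_derivative_at) (simp add: has_real_derivative_iff_has_vector_derivative)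
  then show "continuous_on UNIV (deriv \<psi>)"
    using \<psi>C1 by (simp add: C1_differentiable_on_eq)
qed auto

lemma e_has_derivative: "(e has_derivative (\<lambda>h. deriv \<psi> (\<phi> r) * (n r \<bullet> h))) (at r)"
  unfolding tracking_error_def[abs_def]
  using has_derivative_compose[OF \<phi>_has_derivative \<psi>_has_derivative[unfolded has_field_derivative_def]] by simp

lemma continuous_on_e: "continuous_on A f \<Longrightarrow> continuous_on A (\<lambda>z. e (f z))"
  unfolding tracking_error_def by (intro continuous_on_\<psi> continuous_on_\<phi>)

lemma open_regular: "open regular"
  by (rule open_Collect_neq) (intro continuous_on_n continuous_intros)+

text \<open>The derivative of \<open>v\<close> at \<open>r\<close> in direction \<open>h\<close>, by
  the product and chain rules, written out so that its joint continuity in \<open>r\<close> and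
  \<open>h\<close> can be read off.\<close>

definition Dv :: "real^2 \<Rightarrow> real^2 \<Rightarrow> real^2" where
  "Dv r h = E_rot *v (jacobian n (at r) *v h) -
     ((k * e r) *\<^sub>R (jacobian n (at r) *v h) + (k * (deriv \<psi> (\<phi> r) * (n r \<bullet> h))) *\<^sub>R n r)"

lemma v_has_derivative: "(v has_derivative Dv r) (at r)"
  unfolding guiding_field_def[abs_def] tangent_def Dv_def[abs_def]
  by (intro has_derivative_diff has_derivative_scaleR has_derivative_mult_right e_has_derivative n_has_derivative
    bounded_linear.has_derivative[OF matrix_vector_mul_bounded_linear])

text \<open>Pythagoras: the tangent is the gradient turned by a right angle, so both have the same
  length and are orthogonal.\<close>

lemma inner_v_v: "v r \<bullet> v r = (norm (n r))\<^sup>2 * (1 + (k * e r)\<^sup>2)"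
  by (simp add: guiding_field_def tangent_def inner_diff_left inner_diff_right power2_norm_eq_inner)
     (simp add: power2_eq_square algebra_simps inner_commute)

lemma norm_v: "norm (v r) = norm (n r) * sqrt (1 + (k * e r)\<^sup>2)"
  by (simp add: norm_eq_sqrt_inner[of "v r"] inner_v_v real_sqrt_mult)

lemma v_nz: "r \<in> regular \<Longrightarrow> v r \<noteq> 0"
  using norm_v[of r] by (auto simp: add_pos_nonneg less_imp_neq)

lemma norm_m: "r \<in> regular \<Longrightarrow> norm (m r) = 1"
  using v_nz[of r] by (simp add: desired_dir_def)

text \<open>The derivative of the normalized field: \<open>Dv\<close> divided by the length, minus
  its component along \<open>v\<close>.\<close>

definition Dm :: "real^2 \<Rightarrow> real^2 \<Rightarrow> real^2" where
  "Dm r h = Dv r h /\<^sub>R norm (v r) - (v r \<bullet> Dv r h / norm (v r) ^ 3) *\<^sub>R v r"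

lemma m_has_derivative:
  assumes "r \<in> regular"
  shows "(m has_derivative Dm r) (at r)"
proof -
  have "((\<lambda>r. norm (v r)) has_derivative (\<lambda>h. Dv r h \<bullet> sgn (v r))) (at r)"
    using has_derivative_compose[OF v_has_derivative has_derivative_norm[OF v_nz[OF assms]]] .
  then show ?thesis
    unfolding desired_dir_def[abs_def] Dm_def[abs_def]
    using v_nz[OF assms]
    by (auto intro!: derivative_eq_intros v_has_derivative
        simp: sgn_div_norm power3_eq_cube divide_simps inner_commute)
qed

lemma jacobian_m: "r \<in> regular \<Longrightarrow> jacobian m (at r) *v h = Dm r h"
  using m_has_derivative[of r] jacobian_works[of m "at r"] has_derivative_unique
  unfolding differentiable_def by metis

lemma continuous_on_Dm:
  assumes "continuous_on A f" "continuous_on A g" "\<And>z. z \<in> A \<Longrightarrow> f z \<in> regular"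
  shows "continuous_on A (\<lambda>z. Dm (f z) (g z))"
proof -
  have v: "continuous_on A (\<lambda>z. v (f z))"
    unfolding guiding_field_def tangent_def
    by (intro continuous_intros continuous_on_e continuous_on_n assms)
  have "continuous_on A (\<lambda>z. Dv (f z) (g z))"
    unfolding Dv_def
    by (intro continuous_intros continuous_on_jacobian_n continuous_on_e continuous_on_n continuous_on_deriv_\<psi> continuous_on_\<phi> assms)
  then show ?thesis
    unfolding Dm_def using assms(3) v_nz by (intro continuous_intros v) auto
qed

lemma continuous_on_m:
  assumes "continuous_on A f" "\<And>z. z \<in> A \<Longrightarrow> f z \<in> regular"
  shows "continuous_on A (\<lambda>z. m (f z))"
  unfolding desired_dir_def guiding_field_def tangent_def
  using assms v_nz[unfolded guiding_field_def tangent_def]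
  by (intro continuous_intros continuous_on_e continuous_on_n) auto

end

section \<open>Solutions of the closed-loop system\<close>

text \<open>The quotient is the tangent of the half angle. Away from the branch cut an angle thus
  becomes a smooth function of its sine and cosine.\<close>

lemma half_angle_arctan:
  assumes "- pi < d" "d \<le> pi" "cos d \<noteq> - 1"
  shows "d = 2 * arctan (sin d / (1 + cos d))"
proof -
  have "d \<noteq> pi" using assms by auto
  then have "arctan (tan (d / 2)) = d / 2"
    using assms by (intro arctan_tan) auto
  then show ?thesis by (simp add: tan_half add.commute)
qed

text \<open>The hypotheses concern \<open>cos (d t)\<close> and \<open>sin (d t)\<close> only,
  because \<open>d\<close> itself might jump at the branch cut. Where the cosine is not -1, the
  half-angle formula gives \<open>d' = - K * d\<close>; once the value -1 is excluded,
  \<open>d t * exp (K * t)\<close> has derivative zero on the convex set \<open>S\<close>.\<close>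

lemma angle_exponential_decay:
  fixes d :: "real \<Rightarrow> real"
  assumes S: "open S" "convex S" and K: "K > 0"
    and range: "\<And>t. t \<in> S \<Longrightarrow> - pi < d t \<and> d t \<le> pi"
    and cos: "\<And>t. t \<in> S \<Longrightarrow> ((\<lambda>t. cos (d t)) has_real_derivative K * d t * sin (d t)) (at t)"
    and sin: "\<And>t. t \<in> S \<Longrightarrow> ((\<lambda>t. sin (d t)) has_real_derivative - (K * d t * cos (d t))) (at t)"
  obtains d0 where "\<And>t. t \<in> S \<Longrightarrow> d t = d0 * exp (- K * t)"
proof -
  have der: "(d has_real_derivative - (K * d t)) (at t)" if t: "t \<in> S" "cos (d t) \<noteq> - 1" for t
  proof -
    let ?q = "\<lambda>t. 2 * arctan (sin (d t) / (1 + cos (d t)))"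
    have c0: "1 + cos (d t) \<noteq> 0" using t by auto
    have sq: "(1 + cos (d t))\<^sup>2 + (sin (d t))\<^sup>2 = 2 * (1 + cos (d t))"
      using sin_cos_squared_add[of "d t"] by (simp add: power2_eq_square algebra_simps)
    have "((\<lambda>t. sin (d t) / (1 + cos (d t))) has_real_derivative
       (- (K * d t * cos (d t)) * (1 + cos (d t)) - sin (d t) * (K * d t * sin (d t))) / (1 + cos (d t))\<^sup>2) (at t)"
      using DERIV_divide[OF sin[OF t(1)] DERIV_add[OF DERIV_const cos[OF t(1)]], of 1] c0
      by (simp add: power2_eq_square)
    from DERIV_cmult[OF DERIV_chain2[OF DERIV_arctan this], of 2]
    have "(?q has_real_derivative 2 * (1 / (1 + (sin (d t) / (1 + cos (d t)))\<^sup>2) *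
       ((- (K * d t * cos (d t)) * (1 + cos (d t)) - sin (d t) * (K * d t * sin (d t))) / (1 + cos (d t))\<^sup>2))) (at t)"
      by (simp only: inverse_eq_divide)
    moreover have "2 * (1 / (1 + (sin (d t) / (1 + cos (d t)))\<^sup>2) *
       ((- (K * d t * cos (d t)) * (1 + cos (d t)) - sin (d t) * (K * d t * sin (d t))) / (1 + cos (d t))\<^sup>2))
       = - (K * d t)"
    proof -
      have 1: "1 + (sin (d t) / (1 + cos (d t)))\<^sup>2 = 2 / (1 + cos (d t))"
        using sq c0 by (simp add: power_divide divide_simps power2_eq_square)
      have 2: "- (K * d t * cos (d t)) * (1 + cos (d t)) - sin (d t) * (K * d t * sin (d t)) = - (K * d t) * (1 + cos (d t))"
        using sin_cos_squared_add[of "d t"] by algebra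
      have "2 * (1 / (2 / a) * (b * a / a\<^sup>2)) = b" if "a \<noteq> 0" for a b :: real
        using that by (simp add: power2_eq_square)
      then show ?thesis unfolding 1 2 using c0 .
    qed
    ultimately have q: "(?q has_real_derivative - (K * d t)) (at t)" by simp
    have "(\<lambda>t. cos (d t)) \<midarrow>t\<rightarrow> cos (d t)"
      using DERIV_isCont[OF cos[OF t(1)]] by (simp add: isCont_def)
    then have "\<forall>\<^sub>F z in at t. cos (d z) \<noteq> - 1"
      using t(2) by (rule tendsto_imp_eventually_ne)
    moreover have "\<forall>\<^sub>F z in at t. z \<in> S" using S t by (metis eventually_at_topological)
    ultimately have "\<forall>\<^sub>F z in at t. ?q z = d z"
      by eventually_elim (rule half_angle_arctan[symmetric]; simp add: range)
    moreover have "?q t = d t"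
      using t by (intro half_angle_arctan[symmetric]) (simp_all add: range)
    ultimately have "\<forall>\<^sub>F z in nhds t. ?q z = d z"
      by (simp add: eventually_nhds_conv_at)
    then show ?thesis
      using q by (simp add: DERIV_cong_ev[of t t ?q d])
  qed
  \<comment> \<open>The branch point \<pi> is never hit: just before, the angle would lie near \<open>-\<pi>\<close> and move away from it.\<close>
  have ne: "cos (d t) \<noteq> - 1" if t: "t \<in> S" for t
  proof
    assume c: "cos (d t) = - 1"
    have dt: "d t = pi"
    proof (rule ccontr)
      assume "d t \<noteq> pi"
      then have "\<bar>d t\<bar> < pi" using range[OF t] by linarith
      then have "cos pi < cos \<bar>d t\<bar>" by (intro cos_monotone_0_pi) auto
      then show False using c by simp
    qed
    \<comment> \<open>At the angle \<pi> the sine vanishes with derivative \<open>K * pi\<close>, so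
      it is negative just before. As the cosine is negative too, \<open>d\<close> lies there between
      -\<pi> and -\<pi>/2.\<close>
    have "0 < - (K * d t * cos (d t))" using dt K by simp
    from DERIV_pos_inc_left[OF sin[OF t] this] obtain e1 where
      e1: "e1 > 0" "\<And>h. h > 0 \<Longrightarrow> h < e1 \<Longrightarrow> sin (d (t - h)) < sin (d t)" by auto
    have lim: "((\<lambda>t. cos (d t)) \<longlongrightarrow> - 1) (at t)"
      using DERIV_isCont[OF cos[OF t]] c by (simp add: isCont_def)
    then have "\<forall>\<^sub>F z in at t. cos (d z) < 0" by (rule order_tendstoD) simp
    moreover have "\<forall>\<^sub>F z in at t. z \<in> S" using S t by (metis eventually_at_topological)
    ultimately have "\<forall>\<^sub>F z in at t. cos (d z) < 0 \<and> z \<in> S" by (rule eventually_conj)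
    then obtain e2 where e2: "e2 > 0" "\<And>z. z \<noteq> t \<Longrightarrow> dist z t < e2 \<Longrightarrow> cos (d z) < 0 \<and> z \<in> S"
      by (auto simp: eventually_at)
    define a where "a = t - min e1 e2 / 2"
    have near: "- pi < d z \<and> d z < - pi / 2 \<and> z \<in> S" if "z \<in> {a..<t}" for z
    proof -
      have z: "cos (d z) < 0" "z \<in> S" using e2(2)[of z] that e1 e2 by (auto simp: a_def dist_real_def)
      have "sin (d z) < 0" using e1(2)[of "t - z"] dt that e1 e2 by (auto simp: a_def)
      then have "d z < 0" using range[OF z(2)] sin_ge_zero[of "d z"] by force
      moreover have "d z < - pi / 2" using cos_ge_zero[of "d z"] z(1) \<open>d z < 0\<close> by force
      ultimately show ?thesis using range z by auto
    qed
    have at: "a < t" using e1 e2 by (auto simp: a_def)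
    have mono: "d a \<le> d z" if z: "z \<in> {a..<t}" for z
    proof (rule DERIV_nonneg_imp_nondecreasing[of a z d])
      show "a \<le> z" using z by auto
      fix w assume "a \<le> w" "w \<le> z"
      then have w: "- pi < d w" "d w < - pi / 2" "w \<in> S" using near[of w] z by auto
      have "cos (d w) \<noteq> - 1"
        using cos_monotone_0_pi[of "- d w" pi] w by auto
      moreover have "- (K * d w) \<ge> 0" using K w pi_gt_zero by (simp add: mult_le_0_iff)
      ultimately show "\<exists>y. (d has_real_derivative y) (at w) \<and> 0 \<le> y" using der[OF w(3)] by blast
    qed
    \<comment> \<open>The cosine increases on this range of angles, so its limit -1 at
      \<open>t\<close> would be at least \<open>cos (d a)\<close>, which exceeds -1.\<close>
    have "cos (d a) \<le> cos (d z)" if z: "z \<in> {a..<t}" for z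
      using cos_monotone_0_pi_le[of "- d z" "- d a"] mono[OF z] near[OF z] near[of a] at by auto
    then have "\<forall>\<^sub>F z in at_left t. cos (d a) \<le> cos (d z)"
      using at by (auto simp: eventually_at_left[OF at])
    then have "cos (d a) \<le> - 1"
      using lim by (intro tendsto_lowerbound[of "\<lambda>t. cos (d t)" _ "at_left t"]) (auto simp: filterlim_at_split)
    moreover have "cos (d a) > - 1"
      using cos_monotone_0_pi[of "- d a" pi] near[of a] at by auto
    ultimately show False by simp
  qed
  have "\<exists>d0. \<forall>t\<in>S. d t * exp (K * t) = d0"
  proof (rule has_field_derivative_zero_constant[OF S(2)])
    fix t assume t: "t \<in> S"
    show "((\<lambda>t. d t * exp (K * t)) has_real_derivative 0) (at t within S)"
      by (auto intro!: derivative_eq_intros der[OF t ne[OF t], THEN has_field_derivative_at_within])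
  qed
  then obtain d0 where d0: "\<And>t. t \<in> S \<Longrightarrow> d t * exp (K * t) = d0" by blast
  show thesis
  proof (rule that)
    fix t assume t: "t \<in> S"
    have "d0 * exp (- K * t) = d t * (exp (K * t) * exp (- (K * t)))"
      by (simp only: d0[OF t, symmetric] mult.assoc mult_minus_left)
    then show "d t = d0 * exp (- K * t)" by (simp add: exp_minus)
  qed
qed

lemma has_vector_derivative_heading:
  assumes "(\<alpha> has_real_derivative a) (at t within S)"
  shows "((\<lambda>t. heading (\<alpha> t)) has_vector_derivative - a *\<^sub>R (E_rot *v heading (\<alpha> t))) (at t within S)"
  unfolding has_vector_derivative_real2_iff
  by (auto intro!: derivative_eq_intros assms)

lemma unit_vector_decomp:
  fixes m w :: "real^2"
  assumes "norm m = 1"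
  shows "w = (w \<bullet> m) *\<^sub>R m + (w \<bullet> (E_rot *v m)) *\<^sub>R (E_rot *v m)"
proof -
  have "m $ 1 * m $ 1 + m $ 2 * m $ 2 = 1" using assms by (simp add: norm_eq_1 inner_real2)
  then show ?thesis by (simp add: vec_eq_iff forall_2 inner_real2) algebra
qed

context guided_path
begin

text \<open>A field of unit vectors can only turn: its derivative is orthogonal to it.\<close>

lemma inner_Dm_m: "r \<in> regular \<Longrightarrow> Dm r h \<bullet> m r = 0"
  using v_nz[of r]
  by (simp add: Dm_def desired_dir_def inner_diff_left inner_diff_right power3_eq_cube
      dot_square_norm power2_eq_square inner_commute divide_simps)

text \<open>The derivative is orthogonal to \<open>m\<close>, hence a multiple of
  \<open>E_rot *v m\<close>, and \<open>desired_rate\<close> is by definition minus the coefficient.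
  So \<open>desired_rate\<close> is the angular velocity of the desired direction along the
  motion.\<close>

lemma m_along_curve:
  assumes "(r has_vector_derivative u *\<^sub>R heading a) (at t within S)" "r t \<in> regular"
  shows "((\<lambda>t. m (r t)) has_vector_derivative - desired_rate \<phi> \<psi> k u (r t) a *\<^sub>R (E_rot *v m (r t))) (at t within S)"
proof -
  have "(m \<circ> r has_derivative (Dm (r t) \<circ> (\<lambda>h. h *\<^sub>R u *\<^sub>R heading a))) (at t within S)"
    using assms by (intro diff_chain_within has_derivative_at_withinI[OF m_has_derivative])
      (auto simp: has_vector_derivative_def)
  then have "((\<lambda>t. m (r t)) has_vector_derivative Dm (r t) (u *\<^sub>R heading a)) (at t within S)"
    unfolding has_vector_derivative_def o_def
    using linear_scale[OF has_derivative_linear[OF m_has_derivative[OF assms(2)]]] by simp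
  moreover have "Dm (r t) (u *\<^sub>R heading a) =
    (Dm (r t) (u *\<^sub>R heading a) \<bullet> (E_rot *v m (r t))) *\<^sub>R (E_rot *v m (r t))"
    using unit_vector_decomp[OF norm_m[OF assms(2)], of "Dm (r t) (u *\<^sub>R heading a)"]
    by (simp add: inner_Dm_m[OF assms(2)])
  moreover have "desired_rate \<phi> \<psi> k u (r t) a = - (Dm (r t) (u *\<^sub>R heading a) \<bullet> (E_rot *v m (r t)))"
    using linear_scale[OF has_derivative_linear[OF m_has_derivative[OF assms(2)]]]
    by (simp add: desired_rate_def jacobian_m[OF assms(2)])
  ultimately show ?thesis by simp
qed

end

text \<open>As long as \<open>\<psi> (f t) \<ge> \<epsilon>\<close>, the positive function \<open>f\<close> decreases, and it loses a fixed amount on each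
  of infinitely many intervals on which \<open>N \<ge> \<eta>\<close>. Having dropped below, \<open>\<psi> (f t)\<close> cannot exceed \<open>\<epsilon>\<close>
  again, because \<open>f\<close> has negative slope there.\<close>
lemma eventually_error_le:
  fixes f N s c :: "real \<Rightarrow> real" and \<psi> :: "real \<Rightarrow> real"
  assumes mono: "strict_mono \<psi>" and \<psi>0: "\<psi> 0 = 0" and u: "u > 0" and k: "k > 0"
    and der: "\<And>t. t > 0 \<Longrightarrow> (f has_real_derivative
      u * N t * (s t - k * \<psi> (f t) * c t) / sqrt (1 + (k * \<psi> (f t))\<^sup>2)) (at t)"
    and N: "\<And>t. t > 0 \<Longrightarrow> N t > 0"
    and s: "(s \<longlongrightarrow> 0) at_top" and c: "(c \<longlongrightarrow> 1) at_top"
    and h: "h > 0" and \<eta>: "\<eta> > 0" and freq: "\<exists>\<^sub>F t in at_top. \<forall>z\<in>{t..t+h}. \<eta> \<le> N z"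
    and \<epsilon>: "\<epsilon> > 0"
  shows "\<forall>\<^sub>F t in at_top. \<psi> (f t) \<le> \<epsilon>"
proof -
  define D where "D t = u * N t * (s t - k * \<psi> (f t) * c t) / sqrt (1 + (k * \<psi> (f t))\<^sup>2)" for t
  have der': "(f has_real_derivative D t) (at t)" if "t > 0" for t
    using der[OF that] by (simp add: D_def)
  \<comment> \<open>With \<open>c t > 1 / 2\<close> the damping term is at least
    \<open>k * \<epsilon> / 2\<close>; allowing half of that for \<open>s t\<close> leaves the
    margin \<open>k * \<epsilon> / 4\<close>.\<close>
  have "\<forall>\<^sub>F t in at_top. s t < k * \<epsilon> / 4 \<and> c t > 1 / 2 \<and> t > 0"
    using order_tendstoD(2)[OF s, of "k * \<epsilon> / 4"] order_tendstoD(1)[OF c, of "1/2"] k \<epsilon> eventually_gt_at_top[of 0]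
    by (auto simp: eventually_conj_iff)
  then obtain t1 where t1: "\<And>t. t \<ge> t1 \<Longrightarrow> s t < k * \<epsilon> / 4 \<and> c t > 1 / 2 \<and> t > 0"
    by (auto simp: eventually_at_top_linorder)
  have t1pos: "t1 > 0" using t1[of t1] by auto
  have neg: "s t - k * \<psi> (f t) * c t \<le> - (k * \<epsilon> / 4)" if "t \<ge> t1" "\<psi> (f t) \<ge> \<epsilon>" for t
  proof -
    have "k * \<epsilon> * (1 / 2) \<le> k * \<psi> (f t) * c t"
      using t1[OF that(1)] that(2) k \<epsilon> by (intro mult_mono) auto
    then show ?thesis using t1[OF that(1)] by auto
  qed
  have sq: "sqrt (1 + (k * \<psi> (f t))\<^sup>2) > 0" for t
    by (simp add: add_pos_nonneg)
  have Dneg: "D t < 0" if "t \<ge> t1" "\<psi> (f t) \<ge> \<epsilon>" for t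
  proof -
    have "N t > 0" using N t1[OF that(1)] by auto
    moreover have "s t - k * \<psi> (f t) * c t < 0" using neg[OF that] mult_pos_pos[OF k \<epsilon>] by linarith
    ultimately show ?thesis
      unfolding D_def using u sq[of t] by (intro divide_neg_pos mult_pos_neg) auto
  qed
  have mono': "\<psi> x \<le> \<psi> y" if "x \<le> y" for x y
    using strict_mono_mono[OF mono] that by (auto simp: mono_def)
  have "\<exists>t2\<ge>t1. \<psi> (f t2) < \<epsilon>"
  proof (rule ccontr)
    assume "\<not> ?thesis"
    then have ge: "\<psi> (f t) \<ge> \<epsilon>" if "t \<ge> t1" for t using that by force
    have decr: "f b \<le> f a" if "t1 \<le> a" "a \<le> b" for a b
      using that by (intro DERIV_nonpos_imp_nonincreasing[of a b f])
        (force intro: der' less_imp_le[OF Dneg] ge t1pos order.strict_trans2)+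
    \<comment> \<open>As \<open>f\<close> does not increase after \<open>t1\<close>, neither does
      \<open>\<psi> (f t)\<close>, and the denominator at \<open>t1\<close> bounds all later
      ones.\<close>
    define M where "M = sqrt (1 + (k * \<psi> (f t1))\<^sup>2)"
    have sqM: "sqrt (1 + (k * \<psi> (f t))\<^sup>2) \<le> M" if "t \<ge> t1" for t
      unfolding M_def using mono'[OF decr[OF _ that]] ge[OF that] k \<epsilon>
      by (intro real_sqrt_le_mono add_left_mono power_mono mult_left_mono) auto
    have M: "M > 0" using sq by (simp add: M_def)
    define \<gamma> where "\<gamma> = u * \<eta> * (k * \<epsilon> / 4) / M"
    have \<gamma>: "\<gamma> > 0" using u \<eta> k \<epsilon> M by (simp add: \<gamma>_def)
    have fast: "D z \<le> - \<gamma>" if "z \<ge> t1" "\<eta> \<le> N z" for z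
    proof -
      have "u * \<eta> * (k * \<epsilon> / 4) / M \<le> (u * N z * - (s z - k * \<psi> (f z) * c z)) / sqrt (1 + (k * \<psi> (f z))\<^sup>2)"
        using u \<eta> k \<epsilon> that neg[OF that(1) ge[OF that(1)]] mult_pos_pos[OF k \<epsilon>] sqM[OF that(1)] sq[of z]
        by (intro frac_le mult_mono mult_nonneg_nonneg) linarith+
      also have "\<dots> = - D z"
        unfolding D_def by (simp only: minus_divide_left mult_minus_right minus_minus)
      finally show ?thesis by (simp add: \<gamma>_def)
    qed
    \<comment> \<open>Each window of length \<open>h\<close> with \<open>N\<close> at least
      \<open>\<eta>\<close> costs \<open>f\<close> at least \<open>\<gamma> * h\<close>, and there
      is always a later window. Enough windows make \<open>f\<close> negative, against
      \<open>\<psi> (f t) \<ge> \<epsilon>\<close>.\<close>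
    have "\<exists>t\<ge>t1. f t \<le> f t1 - real n * (\<gamma> * h)" for n
    proof (induction n)
      case 0 show ?case by auto
    next
      case (Suc n)
      then obtain t where t: "t \<ge> t1" "f t \<le> f t1 - real n * (\<gamma> * h)" by auto
      obtain a where a: "a \<ge> t" "\<forall>z\<in>{a..a+h}. \<eta> \<le> N z"
        using freq by (auto simp: frequently_def eventually_at_top_linorder)
      have "f (a + h) + \<gamma> * (a + h) \<le> f a + \<gamma> * a"
      proof (rule DERIV_nonpos_imp_nonincreasing[of a "a + h" "\<lambda>z. f z + \<gamma> * z"])
        fix z assume z: "a \<le> z" "z \<le> a + h"
        have "((\<lambda>z. f z + \<gamma> * z) has_real_derivative D z + \<gamma>) (at z)"
          using z a t t1pos by (auto intro!: derivative_eq_intros der')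
        moreover have "D z + \<gamma> \<le> 0" using fast[of z] z a t by auto
        ultimately show "\<exists>y. ((\<lambda>z. f z + \<gamma> * z) has_real_derivative y) (at z) \<and> y \<le> 0" by blast
      qed (use h in auto)
      moreover have "f a \<le> f t" using decr t a by auto
      ultimately have "f (a + h) \<le> f t1 - real (Suc n) * (\<gamma> * h)"
        using t by (simp add: algebra_simps)
      moreover have "a + h \<ge> t1" using a t h by auto
      ultimately show ?case by blast
    qed
    moreover obtain n :: nat where "f t1 < real n * (\<gamma> * h)"
      using ex_less_of_nat_mult[of "\<gamma> * h" "f t1"] \<gamma> h by auto
    ultimately obtain t where "t \<ge> t1" "f t < 0" by (smt (verit))
    then have "\<psi> (f t) \<le> 0" using mono'[of "f t" 0] \<psi>0 by auto
    with ge[OF \<open>t \<ge> t1\<close>] \<epsilon> show False by auto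
  qed
  then obtain t2 where t2: "t2 \<ge> t1" "\<psi> (f t2) < \<epsilon>" by auto
  have "\<psi> (f t) \<le> \<epsilon>" if ge: "t \<ge> t2" for t
  proof (rule ccontr)
    assume gt: "\<not> ?thesis"
    have "continuous_on {t2..t} f"
      using t1pos t2 by (intro continuous_at_imp_continuous_on ballI DERIV_isCont[OF der']) auto
    \<comment> \<open>At a maximum point of \<open>f\<close> the error exceeds
      \<open>\<epsilon>\<close>, so the point is not \<open>t2\<close>; the negative slope then
      gives larger values just to its left, still inside the interval.\<close>
    then obtain m where m: "m \<in> {t2..t}" "\<And>z. z \<in> {t2..t} \<Longrightarrow> f z \<le> f m"
      using continuous_attains_sup[of "{t2..t}" f] ge by auto
    have "\<epsilon> < \<psi> (f m)" using mono'[OF m(2)[of t]] gt that by auto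
    with t2 have "m > t2" using m(1) by (cases "m = t2") auto
    obtain d where d: "d > 0" "\<And>h. h > 0 \<Longrightarrow> h < d \<Longrightarrow> f m < f (m - h)"
      using DERIV_neg_dec_left[OF der' Dneg, of m] \<open>\<epsilon> < \<psi> (f m)\<close> \<open>m > t2\<close> t2 t1pos by auto
    define z where "z = m - min (d / 2) (m - t2)"
    have "f m < f z" unfolding z_def using d \<open>m > t2\<close> by (intro d(2)) auto
    moreover have "z \<in> {t2..t}" using m(1) \<open>m > t2\<close> d by (auto simp: z_def)
    ultimately show False using m(2)[of z] by auto
  qed
  then show ?thesis by (auto simp: eventually_at_top_linorder)
qed

section \<open>Heading error and path function along a solution\<close>

locale guided_robot = guided_path +
  fixes u K :: real and T :: ereal and x y \<alpha> :: "real \<Rightarrow> real"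
  assumes u_pos: "u > 0" and K_pos: "K > 0"
    and sol: "closed_loop_solution \<phi> \<psi> k u K T x y \<alpha>"
begin

definition "r t = pos x y t"
definition "d t = heading_error \<phi> \<psi> k (r t) (\<alpha> t)"
text \<open>The interior times, at which the derivatives within \<open>time_dom T\<close> are
  ordinary two-sided ones.\<close>

definition "S = {t. 0 < t \<and> ereal t < T}"

lemma S_cases: "S = {0<..} \<and> T = \<infinity> \<or> (\<exists>b>0. S = {0<..<b} \<and> T = ereal b)"
  unfolding S_def using sol by (cases T) (auto simp: closed_loop_solution_def)

lemma open_S: "open S"
  using S_cases by (metis open_greaterThan open_greaterThanLessThan)

lemma convex_S: "convex S"
  using S_cases by (metis convex_real_interval(3,8))

lemma S_time_dom: "t \<in> S \<Longrightarrow> t \<in> time_dom T"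
  by (auto simp: S_def time_dom_def)

lemma at_S: "t \<in> S \<Longrightarrow> at t within time_dom T = at t"
  using S_time_dom by (intro at_within_open_subset[OF _ open_S]) auto

lemma r_component [simp]: "r t $ 1 = x t" "r t $ 2 = y t"
  by (simp_all add: r_def pos_def)

lemma r_regular: "t \<in> time_dom T \<Longrightarrow> r t \<in> regular"
  using sol by (auto simp: closed_loop_solution_def r_def)

lemma component_derivs:
  assumes "t \<in> time_dom T"
  shows "(x has_real_derivative u * cos (\<alpha> t)) (at t within time_dom T)"
    "(y has_real_derivative u * sin (\<alpha> t)) (at t within time_dom T)"
    "(\<alpha> has_real_derivative desired_rate \<phi> \<psi> k u (r t) (\<alpha> t) - K * d t) (at t within time_dom T)"
  using sol assms unfolding closed_loop_solution_def d_def r_def by blast+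

lemma r_deriv:
  assumes "t \<in> S"
  shows "(r has_vector_derivative u *\<^sub>R heading (\<alpha> t)) (at t)"
  using component_derivs(1,2)[OF S_time_dom[OF assms]]
  by (simp add: has_vector_derivative_real2_iff at_S[OF assms])

lemma \<alpha>_deriv:
  assumes "t \<in> S"
  shows "(\<alpha> has_real_derivative desired_rate \<phi> \<psi> k u (r t) (\<alpha> t) - K * d t) (at t)"
  using component_derivs(3)[OF S_time_dom[OF assms]] by (simp add: at_S[OF assms])

lemma
  assumes "t \<in> time_dom T"
  shows d_range: "- pi < d t \<and> d t \<le> pi"
    and heading_eq: "heading (\<alpha> t) = cos (d t) *\<^sub>R m (r t) - sin (d t) *\<^sub>R (E_rot *v m (r t))"
  using directed_angle_props[OF norm_m[OF r_regular[OF assms]] norm_heading[of "\<alpha> t"]]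
  unfolding d_def heading_error_def by blast+

text \<open>Sine and cosine of the heading error become smooth expressions in position and heading,
  which can be differentiated even if the angle is at the branch cut.\<close>

lemma cos_sin_d:
  assumes "t \<in> time_dom T"
  shows "cos (d t) = m (r t) \<bullet> heading (\<alpha> t)" "sin (d t) = - ((E_rot *v m (r t)) \<bullet> heading (\<alpha> t))"
  using norm_m[OF r_regular[OF assms]]
  unfolding heading_eq[OF assms] by (simp_all add: inner_diff_right norm_eq_1)

text \<open>The direction \<open>m\<close> turns at the rate \<omega> and the heading at the rate
  \<open>\<omega> - K * d t\<close>. The common term cancels in the inner products, which leaves the
  hypotheses of \<open>angle_exponential_decay\<close>.\<close>

lemma d_exponential: obtains d0 where "\<And>t. t \<in> S \<Longrightarrow> d t = d0 * exp (- K * t)"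
proof (rule angle_exponential_decay[OF open_S convex_S K_pos])
  fix t assume t: "t \<in> S"
  note [simp] = S_time_dom[OF t]
  define \<omega> where "\<omega> = desired_rate \<phi> \<psi> k u (r t) (\<alpha> t)"
  note m' = m_along_curve[OF r_deriv[OF t] r_regular, folded \<omega>_def, simplified]
  note w' = has_vector_derivative_heading[OF \<alpha>_deriv[OF t], folded \<omega>_def]
  have "((\<lambda>t. m (r t) \<bullet> heading (\<alpha> t)) has_real_derivative K * d t * sin (d t)) (at t)"
    using bounded_bilinear.has_vector_derivative[OF bounded_bilinear_inner m' w']
    by (simp add: has_real_derivative_iff_has_vector_derivative cos_sin_d inner_E_rot_right algebra_simps)
  then show "((\<lambda>t. cos (d t)) has_real_derivative K * d t * sin (d t)) (at t)"
    by (rule has_field_derivative_transform_within_open[OF _ open_S t]) (simp add: cos_sin_d S_time_dom)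
  have "((\<lambda>t. - ((E_rot *v m (r t)) \<bullet> heading (\<alpha> t))) has_real_derivative - (K * d t * cos (d t))) (at t)"
    using has_vector_derivative_minus[OF bounded_bilinear.has_vector_derivative[OF bounded_bilinear_inner
      bounded_linear.has_vector_derivative[OF matrix_vector_mul_bounded_linear[of E_rot] m'] w']]
    by (simp add: has_real_derivative_iff_has_vector_derivative cos_sin_d inner_E_rot_right algebra_simps)
  then show "((\<lambda>t. sin (d t)) has_real_derivative - (K * d t * cos (d t))) (at t)"
    by (rule has_field_derivative_transform_within_open[OF _ open_S t]) (simp add: cos_sin_d S_time_dom)
qed (use d_range S_time_dom in auto)

text \<open>By the chain rule the derivative is \<open>u\<close> times the inner product of gradient
  and heading. The heading is split along \<open>m\<close> and \<open>E_rot *v m\<close>, whose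
  inner products with the gradient follow from the formula for \<open>v\<close>.\<close>

lemma \<phi>_deriv:
  assumes t: "t \<in> S"
  shows "((\<lambda>t. \<phi> (r t)) has_real_derivative
    u * norm (n (r t)) * (sin (d t) - k * \<psi> (\<phi> (r t)) * cos (d t)) / sqrt (1 + (k * \<psi> (\<phi> (r t)))\<^sup>2)) (at t)"
proof -
  note td = S_time_dom[OF t]
  have nv: "norm (v (r t)) \<noteq> 0" "norm (n (r t)) \<noteq> 0" using v_nz[OF r_regular[OF td]] r_regular[OF td] by auto
  have 1: "n (r t) \<bullet> m (r t) = - k * e (r t) * (norm (n (r t)))\<^sup>2 / norm (v (r t))"
    by (simp add: desired_dir_def guiding_field_def tangent_def inner_diff_right power2_norm_eq_inner divide_inverse)
  have 2: "n (r t) \<bullet> (E_rot *v m (r t)) = - (norm (n (r t)))\<^sup>2 / norm (v (r t))"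
    by (simp add: inner_E_rot_right desired_dir_def guiding_field_def tangent_def inner_diff_right
        power2_norm_eq_inner divide_inverse)
  have "(\<phi> \<circ> r has_derivative (\<lambda>h. n (r t) \<bullet> h) \<circ> (\<lambda>h. h *\<^sub>R u *\<^sub>R heading (\<alpha> t))) (at t)"
    using r_deriv[OF t] by (intro diff_chain_at \<phi>_has_derivative) (auto simp: has_vector_derivative_def)
  then have "((\<lambda>t. \<phi> (r t)) has_real_derivative u * (n (r t) \<bullet> heading (\<alpha> t))) (at t)"
    by (simp add: has_real_derivative_iff_has_vector_derivative has_vector_derivative_def o_def mult_ac)
  moreover have "u * (n (r t) \<bullet> heading (\<alpha> t)) =
    u * norm (n (r t)) * (sin (d t) - k * e (r t) * cos (d t)) / sqrt (1 + (k * e (r t))\<^sup>2)"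
    using nv unfolding heading_eq[OF td] inner_diff_right inner_scaleR_right 1 2
    by (simp add: norm_v field_simps power2_eq_square)
  ultimately show ?thesis by (simp add: tracking_error_def)
qed

end

section \<open>Infinite time: convergence to the path\<close>

lemma edist_tendsto_0I:
  assumes "\<And>\<kappa>::real. \<kappa> > 0 \<Longrightarrow> \<forall>\<^sub>F t in F. edist_to_set (r t) A < ereal \<kappa>"
  shows "((\<lambda>t. edist_to_set (r t) A) \<longlongrightarrow> 0) F"
proof (rule order_tendstoI)
  fix a :: ereal assume "a < 0"
  then have "a < edist_to_set q A" for q
    unfolding edist_to_set_def by (rule less_le_trans) (auto intro: INF_greatest)
  then show "\<forall>\<^sub>F t in F. a < edist_to_set (r t) A" by simp
next
  fix a :: ereal assume "0 < a"
  then obtain \<kappa> where "0 < ereal \<kappa>" "ereal \<kappa> < a" using ereal_dense2 by blast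
  then show "\<forall>\<^sub>F t in F. edist_to_set (r t) A < a"
    using assms[of \<kappa>] by (auto elim!: eventually_mono intro: less_trans)
qed

text \<open>The triangle inequality for lower bounds, taken point by point, so that it also covers
  an empty set with its infinite distance.\<close>

lemma edist_to_set_triangle:
  assumes "ereal \<kappa> \<le> edist_to_set r A" "dist r s \<le> \<kappa> - \<kappa>'"
  shows "ereal \<kappa>' \<le> edist_to_set s A"
  unfolding edist_to_set_def
proof (rule INF_greatest)
  fix a assume "a \<in> A"
  then have "ereal \<kappa> \<le> ereal (dist r a)"
    using assms(1) by (auto simp: edist_to_set_def le_INF_iff)
  then show "ereal \<kappa>' \<le> ereal (dist s a)"
    using assms(2) dist_triangle[of r a s] by simp
qed

lemma INF_ereal_pos_imp_lower_bound:
  fixes f :: "'a \<Rightarrow> real"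
  assumes "(INF r\<in>B. ereal (f r)) > 0"
  obtains \<eta> where "\<eta> > 0" "\<And>r. r \<in> B \<Longrightarrow> \<eta> \<le> f r"
proof -
  obtain \<eta> where \<eta>: "0 < ereal \<eta>" "ereal \<eta> < (INF r\<in>B. ereal (f r))"
    using ereal_dense2[OF assms] by blast
  have "\<eta> \<le> f r" if "r \<in> B" for r
    using less_le_trans[OF \<eta>(2) INF_lower[OF that]] by simp
  with \<eta> show thesis by (intro that) auto
qed

context guided_robot
begin

lemma r_lipschitz:
  assumes "s \<in> S" "t \<in> S"
  shows "dist (r s) (r t) \<le> u * \<bar>s - t\<bar>"
proof -
  have "norm (r s - r t) \<le> u * norm (s - t)"
  proof (rule differentiable_bound[OF convex_S _ _ assms])
    fix z assume "z \<in> S"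
    then show "(r has_derivative (\<lambda>h. h *\<^sub>R u *\<^sub>R heading (\<alpha> z))) (at z within S)"
      using r_deriv has_derivative_at_withinI unfolding has_vector_derivative_def by blast
    show "onorm (\<lambda>h. h *\<^sub>R u *\<^sub>R heading (\<alpha> z)) \<le> u"
      by (rule onorm_le) (use u_pos in \<open>simp add: abs_mult mult.commute\<close>)
  qed
  then show ?thesis by (simp add: dist_norm)
qed

text \<open>By \<open>far\<close>, the robot is at distance at least some \<kappa> from the critical
  set at arbitrarily late times. Its bounded speed keeps it away for a fixed time afterwards, during
  which \<open>A3\<close> bounds the gradient from below. So \<open>eventually_error_le\<close>
  applies, once for each sign of the error.\<close>

lemma error_tendsto_0_or_critical:
  assumes T: "T = \<infinity>"
    and A3: "\<And>\<kappa>::real. \<kappa> > 0 \<Longrightarrow>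
      (INF r\<in>{r. edist_to_set r (critical_set \<phi>) \<ge> ereal \<kappa>}. ereal (norm (n r))) > 0"
    and far: "\<not> ((\<lambda>t. edist_to_set (r t) (critical_set \<phi>)) \<longlongrightarrow> 0) at_top"
    and \<epsilon>: "\<epsilon> > 0"
  shows "\<forall>\<^sub>F t in at_top. \<bar>e (r t)\<bar> \<le> \<epsilon>"
proof -
  have S: "t \<in> S \<longleftrightarrow> t > 0" for t unfolding S_def using T by simp
  have reg: "norm (n (r t)) > 0" if "t > 0" for t
    using r_regular[OF S_time_dom, of t] that S by simp
  obtain d0 where d0: "\<And>t. t \<in> S \<Longrightarrow> d t = d0 * exp (- K * t)" using d_exponential by blast
  have "filterlim (\<lambda>t. - K * t) at_bot at_top"
    using K_pos by (intro filterlim_tendsto_neg_mult_at_bot[OF tendsto_const _ filterlim_ident]) simp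
  then have "((\<lambda>t. d0 * exp (- K * t)) \<longlongrightarrow> 0) at_top"
    by (intro tendsto_mult_right_zero filterlim_compose[OF exp_at_bot])
  moreover have "\<forall>\<^sub>F t in at_top. d0 * exp (- K * t) = d t"
    using eventually_gt_at_top[of 0] by eventually_elim (simp add: d0 S)
  ultimately have d: "(d \<longlongrightarrow> 0) at_top" by (rule Lim_transform_eventually)
  have sin: "((\<lambda>t. sin (d t)) \<longlongrightarrow> 0) at_top" and cos: "((\<lambda>t. cos (d t)) \<longlongrightarrow> 1) at_top"
    using tendsto_sin[OF d] tendsto_cos[OF d] by simp_all
  obtain \<kappa> :: real where \<kappa>: "\<kappa> > 0" and freq: "\<exists>\<^sub>F t in at_top. ereal \<kappa> \<le> edist_to_set (r t) (critical_set \<phi>)"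
    using far edist_tendsto_0I[of r "critical_set \<phi>" at_top]
    by (auto simp: frequently_def not_le)
  obtain \<eta> where \<eta>: "\<eta> > 0" "\<And>q. ereal (\<kappa> / 2) \<le> edist_to_set q (critical_set \<phi>) \<Longrightarrow> \<eta> \<le> norm (n q)"
    using INF_ereal_pos_imp_lower_bound[OF A3[of "\<kappa> / 2"]] \<kappa> by auto
  \<comment> \<open>Within this time the robot covers at most \<open>\<kappa> / 2\<close>, so half
    of the distance \<kappa> remains.\<close>
  define h where "h = \<kappa> / (2 * u)"
  have h: "h > 0" using \<kappa> u_pos by (simp add: h_def)
  have "\<exists>\<^sub>F t in at_top. t > 0 \<and> ereal \<kappa> \<le> edist_to_set (r t) (critical_set \<phi>)"
    using frequently_eventually_frequently[OF freq eventually_gt_at_top[of 0]] by (simp add: conj_commute)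
  then have freq': "\<exists>\<^sub>F t in at_top. \<forall>z\<in>{t..t+h}. \<eta> \<le> norm (n (r z))"
  proof (rule frequently_elim1, intro ballI)
    fix t z assume t: "t > 0 \<and> ereal \<kappa> \<le> edist_to_set (r t) (critical_set \<phi>)" and z: "z \<in> {t..t+h}"
    have "dist (r t) (r z) \<le> u * \<bar>t - z\<bar>" using t z by (intro r_lipschitz) (auto simp: S)
    also have "\<dots> \<le> u * h" using z u_pos by (intro mult_left_mono) auto
    also have "\<dots> = \<kappa> - \<kappa> / 2" using u_pos by (simp add: h_def field_simps)
    finally show "\<eta> \<le> norm (n (r z))"
      using t by (blast intro: \<eta>(2) edist_to_set_triangle[of \<kappa> "r t"])
  qed
  have "\<forall>\<^sub>F t in at_top. \<psi> (\<phi> (r t)) \<le> \<epsilon>"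
    using eventually_error_le[of \<psi> u k "\<lambda>t. \<phi> (r t)" "\<lambda>t. norm (n (r t))" "\<lambda>t. sin (d t)" "\<lambda>t. cos (d t)",
        OF \<psi>_mono \<psi>_0 u_pos k_pos _ reg sin cos h \<eta>(1) freq' \<epsilon>] \<phi>_deriv S by blast
  \<comment> \<open>The lower bound is the upper bound for the reflected data: the negated path
    function, the odd reflection of \<psi>, which is again strictly increasing, and the negated
    sine.\<close>
  moreover have "\<forall>\<^sub>F t in at_top. - \<psi> (- (- \<phi> (r t))) \<le> \<epsilon>"
  proof (rule eventually_error_le[of "\<lambda>z. - \<psi> (- z)" u k "\<lambda>t. - \<phi> (r t)" "\<lambda>t. norm (n (r t))" "\<lambda>t. - sin (d t)" "\<lambda>t. cos (d t)", OF _ _ u_pos k_pos _ reg _ cos h \<eta>(1) freq' \<epsilon>])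
    show "strict_mono (\<lambda>z. - \<psi> (- z))" using \<psi>_mono by (auto simp: strict_mono_def)
    show "((\<lambda>t. - sin (d t)) \<longlongrightarrow> 0) at_top" using tendsto_minus[OF sin] by simp
    fix t :: real assume "t > 0"
    then have "t \<in> S" by (simp add: S)
    have eq: "u * N * (- s - k * - p * c) / q = - (u * N * (s - k * p * c) / q)" for N s p c q
    proof -
      have "u * N * (- s - k * - p * c) = - (u * N * (s - k * p * c))" by (simp add: algebra_simps)
      then show ?thesis by (simp only: minus_divide_left)
    qed
    show "((\<lambda>t. - \<phi> (r t)) has_real_derivative u * norm (n (r t)) *
      (- sin (d t) - k * - \<psi> (- (- \<phi> (r t))) * cos (d t)) / sqrt (1 + (k * - \<psi> (- (- \<phi> (r t))))\<^sup>2)) (at t)"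
      unfolding eq using DERIV_minus[OF \<phi>_deriv[OF \<open>t \<in> S\<close>]] by simp
  qed (simp_all add: \<psi>_0)
  ultimately show ?thesis
    by eventually_elim (simp add: tracking_error_def abs_le_iff)
qed

text \<open>By \<open>A1\<close>, the error is at least some \<eta> wherever the path is at distance
  \<kappa> or more, while along the solution it is eventually at most
  \<open>\<eta> / 2\<close>.\<close>

lemma infinite_time_alternative:
  assumes T: "T = \<infinity>"
    and A1: "\<And>\<kappa>::real. \<kappa> > 0 \<Longrightarrow>
      (INF r\<in>{r. edist_to_set r (path_set \<phi>) \<ge> ereal \<kappa>}. ereal \<bar>e r\<bar>) > 0"
    and A3: "\<And>\<kappa>::real. \<kappa> > 0 \<Longrightarrow>
      (INF r\<in>{r. edist_to_set r (critical_set \<phi>) \<ge> ereal \<kappa>}. ereal (norm (n r))) > 0"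
    and far: "\<not> ((\<lambda>t. edist_to_set (r t) (critical_set \<phi>)) \<longlongrightarrow> 0) at_top"
  shows "((\<lambda>t. edist_to_set (r t) (path_set \<phi>)) \<longlongrightarrow> 0) at_top"
proof (rule edist_tendsto_0I)
  fix \<kappa> :: real assume "\<kappa> > 0"
  then obtain \<eta> where \<eta>: "\<eta> > 0" "\<And>q. ereal \<kappa> \<le> edist_to_set q (path_set \<phi>) \<Longrightarrow> \<eta> \<le> \<bar>e q\<bar>"
    using INF_ereal_pos_imp_lower_bound[OF A1] by (metis mem_Collect_eq)
  have "\<forall>\<^sub>F t in at_top. \<bar>e (r t)\<bar> \<le> \<eta> / 2"
    using \<eta> by (intro error_tendsto_0_or_critical[OF T A3 far]) auto
  then show "\<forall>\<^sub>F t in at_top. edist_to_set (r t) (path_set \<phi>) < ereal \<kappa>"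
  proof eventually_elim
    case (elim t)
    with \<eta>(1) have "\<not> \<eta> \<le> \<bar>e (r t)\<bar>" by linarith
    then show ?case using \<eta>(2)[of "r t"] by force
  qed
qed

end

section \<open>Finite time: prolongation past a regular limit\<close>

text \<open>The difference of the two vectors obeys the same rotation equation, which preserves
  length, and it vanishes at \<open>b\<close>.\<close>

lemma unit_vectors_same_rotation_rate:
  fixes a w :: "real \<Rightarrow> real^2"
  assumes "\<And>t. t \<in> {b..c} \<Longrightarrow> (a has_vector_derivative - \<omega> t *\<^sub>R (E_rot *v a t)) (at t within {b..c})"
    and "\<And>t. t \<in> {b..c} \<Longrightarrow> (w has_vector_derivative - \<omega> t *\<^sub>R (E_rot *v w t)) (at t within {b..c})"
    and "a b = w b" and t: "t \<in> {b..c}"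
  shows "a t = w t"
proof -
  define z where "z t = a t - w t" for t
  have z: "(z has_vector_derivative - \<omega> t *\<^sub>R (E_rot *v z t)) (at t within {b..c})" if "t \<in> {b..c}" for t
    using has_vector_derivative_diff[OF assms(1,2)[OF that]]
    by (simp add: z_def[abs_def] matrix_vector_mult_diff_distrib algebra_simps)
  have "((\<lambda>t. z t \<bullet> z t) has_real_derivative 0) (at t within {b..c})" if "t \<in> {b..c}" for t
    using bounded_bilinear.has_vector_derivative[OF bounded_bilinear_inner z[OF that] z[OF that]]
    by (simp add: has_real_derivative_iff_has_vector_derivative)
  then have "\<exists>k. \<forall>t\<in>{b..c}. z t \<bullet> z t = k"
    by (intro has_field_derivative_zero_constant) auto
  then have "z t \<bullet> z t = z b \<bullet> z b" using t by auto
  then show ?thesis using assms(3) by (simp add: z_def)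
qed

lemma at_within_time_dom_less:
  assumes "t < b" "b \<le> c"
  shows "at t within time_dom (ereal c) = at t within time_dom (ereal b)"
  using assms by (intro at_within_nhd[of t "{..<b}"]) (auto simp: time_dom_def)

context guided_robot
begin

lemma finite_time_limit:
  assumes T: "T = ereal b"
  obtains p where "(r \<longlongrightarrow> p) (at_left b)"
proof -
  have S: "t \<in> S \<longleftrightarrow> 0 < t \<and> t < b" for t unfolding S_def using T by simp
  have b: "0 < b" using S_cases T by auto
  have bound: "\<bar>u * cos z\<bar> \<le> u" "\<bar>u * sin z\<bar> \<le> u" for z
    using u_pos by (simp_all add: abs_mult)
  have xy: "(x has_real_derivative u * cos (\<alpha> t)) (at t)" "(y has_real_derivative u * sin (\<alpha> t)) (at t)"
    if "0 < t" "t < b" for t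
    using r_deriv[of t] that S by (simp_all add: has_vector_derivative_real2_iff)
  obtain px where px: "(x \<longlongrightarrow> px) (at_left b)"
    by (rule left_limit_of_bounded_derivative[OF b xy(1) bound(1)])
  obtain py where py: "(y \<longlongrightarrow> py) (at_left b)"
    by (rule left_limit_of_bounded_derivative[OF b xy(2) bound(2)])
  have "((\<lambda>t. r t $ i) \<longlongrightarrow> vector [px, py] $ i) (at_left b)" for i
    using exhaust_2[of i] px py by auto
  then show thesis by (intro that[of "vector [px, py]"] vec_tendstoI)
qed

text \<open>Past \<open>b\<close> the position \<open>q\<close> solves the equation with prescribed
  heading error, and the angle \<beta> is the integral of the closed-loop rate. Both
  \<open>heading (\<beta> t)\<close> and \<open>W t (q t)\<close> rotate at that rate from the same
  start, so they coincide, and the glued functions solve the closed-loop system.\<close>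

lemma extension_past_regular_limit:
  assumes T: "T = ereal b" and p: "(r \<longlongrightarrow> p) (at_left b)" and reg: "p \<in> regular"
  obtains c x' y' \<alpha>' where "b < c" "closed_loop_solution \<phi> \<psi> k u K (ereal c) x' y' \<alpha>'"
    "\<And>t. t \<in> time_dom T \<Longrightarrow> x' t = x t \<and> y' t = y t \<and> \<alpha>' t = \<alpha> t"
proof -
  have S: "t \<in> S \<longleftrightarrow> 0 < t \<and> t < b" for t unfolding S_def using T by simp
  have b: "0 < b" using S_cases T by auto
  obtain d0 where d0: "\<And>t. t \<in> S \<Longrightarrow> d t = d0 * exp (- K * t)" using d_exponential by blast
  define \<delta> where "\<delta> t = d0 * exp (- K * t)" for t
  have \<delta>_deriv: "(\<delta> has_real_derivative - (K * \<delta> t)) (at t within A)" for t A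
    unfolding \<delta>_def by (auto intro!: derivative_eq_intros)
  have \<delta>_cont: "continuous_on A (\<lambda>z. \<delta> (f z))" if "continuous_on A f" for A and f :: "real \<times> (real^2) \<Rightarrow> real"
    unfolding \<delta>_def by (intro continuous_intros that)
  \<comment> \<open>Half way to \<open>b\<close> the modulus is at most \<pi>, and from there on a
    nonzero \<delta> strictly decays. So \<delta> stays within the range of
    \<open>directed_angle\<close>, which will return exactly this value.\<close>
  have \<delta>_range: "- pi < \<delta> t" "\<delta> t \<le> pi" if "b \<le> t" for t
  proof -
    have "\<bar>\<delta> t\<bar> = \<bar>d0\<bar> * exp (- K * t)" by (simp add: \<delta>_def abs_mult)
    have half: "b / 2 \<in> S" using b by (simp add: S)
    have "\<bar>\<delta> t\<bar> < pi"
    proof (cases "d0 = 0")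
      case True then show ?thesis by (simp add: \<delta>_def)
    next
      case False
      have "K * (b / 2) < K * t" using K_pos b that by (intro mult_strict_left_mono) auto
      then have "\<bar>d0\<bar> * exp (- K * t) < \<bar>d0\<bar> * exp (- K * (b / 2))" using False by simp
      also have "\<dots> = \<bar>d (b / 2)\<bar>" by (simp add: d0[OF half] abs_mult)
      also have "\<dots> \<le> pi" using d_range[OF S_time_dom[OF half]] by linarith
      finally show ?thesis by (simp add: \<delta>_def abs_mult)
    qed
    then show "- pi < \<delta> t" "\<delta> t \<le> pi" by linarith+
  qed
  \<comment> \<open>\<open>W t q\<close> is the heading at \<open>q\<close> whose heading error is
    \<open>\<delta> t\<close>, and \<open>R t q\<close> is the value of \<open>desired_rate\<close>
    for it. Both make sense without an angle that represents the heading.\<close>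
  define W where "W t q = cos (\<delta> t) *\<^sub>R m q - sin (\<delta> t) *\<^sub>R (E_rot *v m q)" for t q
  define R where "R t q = - ((u *\<^sub>R Dm q (W t q)) \<bullet> (E_rot *v m q))" for t q
  have W_cont: "continuous_on (UNIV \<times> regular) (\<lambda>(t, q). W t q)"
    unfolding W_def case_prod_beta by (intro continuous_intros continuous_on_m \<delta>_cont) auto
  have A_cont: "continuous_on (UNIV \<times> regular) (\<lambda>(t, q). R t q - K * \<delta> t)"
    unfolding R_def case_prod_beta
    by (intro continuous_intros continuous_on_m continuous_on_Dm \<delta>_cont W_cont[unfolded case_prod_beta]) auto
  have rate: "desired_rate \<phi> \<psi> k u q a = R t q" if "q \<in> regular" "heading a = W t q" for a t q
    by (simp add: desired_rate_def R_def that(2) jacobian_m[OF that(1)])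
  have heading_W: "heading (\<alpha> t) = W t (r t)" if "t \<in> S" for t
    using heading_eq[OF S_time_dom[OF that]] d0[OF that] by (simp add: W_def \<delta>_def)
  have \<alpha>_der: "(\<alpha> has_real_derivative R t (r t) - K * \<delta> t) (at t)" if "0 < t" "t < b" for t
    using \<alpha>_deriv[of t] rate[OF r_regular heading_W, of t] d0[of t] S_time_dom[of t] that S
    by (simp add: \<delta>_def)
  have evS: "\<forall>\<^sub>F t in at_left b. t \<in> S"
    using b by (auto simp: eventually_at_left[OF b] S)
  then have ev: "\<forall>\<^sub>F t in at_left b. (t, r t) \<in> UNIV \<times> regular"
    by eventually_elim (use r_regular S_time_dom in blast)
  have pr: "((\<lambda>t. (t, r t)) \<longlongrightarrow> (b, p)) (at_left b)"
    by (intro tendsto_Pair p tendsto_ident_at)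
  have A_lim: "((\<lambda>t. R t (r t) - K * \<delta> t) \<longlongrightarrow> R b p - K * \<delta> b) (at_left b)"
    using continuous_on_tendsto_compose[OF A_cont pr _ ev] reg by simp
  have W_lim: "((\<lambda>t. W t (r t)) \<longlongrightarrow> W b p) (at_left b)"
    using continuous_on_tendsto_compose[OF W_cont pr _ ev] reg by simp

  \<comment> \<open>The derivative of \<alpha> converges at \<open>b\<close>, hence is bounded near
    it, so \<alpha> has a limit; by continuity its heading is \<open>W b p\<close>.\<close>
  obtain a where a: "(\<alpha> \<longlongrightarrow> a) (at_left b)"
  proof -
    have "\<forall>\<^sub>F t in at_left b. \<bar>R t (r t) - K * \<delta> t\<bar> < \<bar>R b p - K * \<delta> b\<bar> + 1"
      by (rule order_tendstoD(2)[OF tendsto_rabs[OF A_lim]]) simp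
    then obtain b' where b': "b' < b" "\<And>t. b' < t \<Longrightarrow> t < b \<Longrightarrow> \<bar>R t (r t) - K * \<delta> t\<bar> < \<bar>R b p - K * \<delta> b\<bar> + 1"
      by (auto simp: eventually_at_left[OF b])
    show thesis
      by (rule left_limit_of_bounded_derivative[of "max b' 0" b \<alpha> "\<lambda>t. R t (r t) - K * \<delta> t" "\<bar>R b p - K * \<delta> b\<bar> + 1"])
        (use b b' \<alpha>_der that in \<open>auto intro: less_imp_le\<close>)
  qed
  have "((\<lambda>t. heading (\<alpha> t)) \<longlongrightarrow> heading a) (at_left b)"
    by (rule continuous_on_tendsto_compose[OF continuous_on_heading[OF continuous_on_id[of UNIV]] a]) auto
  moreover have "((\<lambda>t. heading (\<alpha> t)) \<longlongrightarrow> W b p) (at_left b)"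
    by (rule Lim_transform_eventually[OF W_lim eventually_mono[OF evS]]) (simp add: heading_W)
  ultimately have heading_a: "heading a = W b p"
    by (rule tendsto_unique[OF trivial_limit_at_left_real])

  obtain \<rho> where \<rho>: "\<rho> > 0" "cball p \<rho> \<subseteq> regular"
    using open_regular reg by (meson open_contains_cball)
  have m_der: "(m has_derivative Dm q) (at q)" if "q \<in> cball p \<rho>" for q
    using m_has_derivative that \<rho> by blast
  have Dm_cont: "continuous_on (cball p \<rho> \<times> sphere 0 1) (\<lambda>(q, h). Dm q h)"
    unfolding case_prod_beta using \<rho> by (intro continuous_on_Dm continuous_intros) auto
  obtain L where L: "\<And>q s. q \<in> cball p \<rho> \<Longrightarrow> s \<in> cball p \<rho> \<Longrightarrow> norm (m q - m s) \<le> L * norm (q - s)"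
    using C1_imp_lipschitz_on_cball[OF m_der Dm_cont] by metis
  have uW_cont: "continuous_on ({b..b + 1} \<times> cball p \<rho>) (\<lambda>(t, q). u *\<^sub>R W t q)"
    unfolding case_prod_beta using \<rho>(2)
    by (intro continuous_on_scaleR continuous_on_const continuous_on_subset[OF W_cont[unfolded case_prod_beta]]) auto
  have uW_lipschitz: "norm (u *\<^sub>R W t q - u *\<^sub>R W t s) \<le> u * (2 * L) * norm (q - s)"
    if qs: "q \<in> cball p \<rho>" "s \<in> cball p \<rho>" for t q s
  proof -
    have eq: "W t q - W t s = cos (\<delta> t) *\<^sub>R (m q - m s) - sin (\<delta> t) *\<^sub>R (E_rot *v (m q - m s))"
      by (simp add: W_def algebra_simps matrix_vector_mult_diff_distrib)
    have "norm (W t q - W t s) \<le> \<bar>cos (\<delta> t)\<bar> * norm (m q - m s) + \<bar>sin (\<delta> t)\<bar> * norm (m q - m s)"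
      unfolding eq by (rule order_trans[OF norm_triangle_ineq4]) simp
    also have "\<dots> \<le> 1 * norm (m q - m s) + 1 * norm (m q - m s)"
      by (rule add_mono; rule mult_right_mono; simp)
    also have "\<dots> \<le> 2 * L * norm (q - s)"
      using L[OF qs] by linarith
    finally show ?thesis
      using u_pos by (simp flip: scaleR_diff_right add: mult.assoc)
  qed
  have "b < b + 1" by simp
  from picard_lindeloef_local[OF this \<rho>(1) uW_cont uW_lipschitz]
  obtain c q where c: "b < c" and q: "q b = p" "\<And>t. t \<in> {b..c} \<Longrightarrow> q t \<in> cball p \<rho>"
    "\<And>t. t \<in> {b..c} \<Longrightarrow> (q has_vector_derivative u *\<^sub>R W t (q t)) (at t within {b..c})"
    by metis
  have qreg: "q t \<in> regular" if "t \<in> {b..c}" for t using q(2)[OF that] \<rho> by auto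
  have qcont: "continuous_on {b..c} q"
    unfolding continuous_on_eq_continuous_within using q(3) has_vector_derivative_continuous by blast
  have Aq_cont: "continuous_on {b..c} (\<lambda>t. R t (q t) - K * \<delta> t)"
  proof -
    have "continuous_on {b..c} (\<lambda>t. (t, q t))" by (intro continuous_intros qcont)
    moreover have "(\<lambda>t. (t, q t)) ` {b..c} \<subseteq> UNIV \<times> regular" using qreg by blast
    ultimately show ?thesis using continuous_on_compose2[OF A_cont] by force
  qed
  \<comment> \<open>Integrating from \<open>a\<close> selects the representative of the angle that
    continues \<alpha>, with the required derivative built in.\<close>
  define \<beta> where "\<beta> t = a + integral {b..t} (\<lambda>t. R t (q t) - K * \<delta> t)" for t
  have \<beta>b: "\<beta> b = a" by (simp add: \<beta>_def)
  have \<beta>: "(\<beta> has_real_derivative R t (q t) - K * \<delta> t) (at t within {b..c})" if "t \<in> {b..c}" for t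
    unfolding \<beta>_def has_real_derivative_iff_has_vector_derivative
    using integral_has_vector_derivative[OF Aq_cont that] by (auto intro!: derivative_eq_intros)
  have W_deriv: "((\<lambda>t. W t (q t)) has_vector_derivative - (R t (q t) - K * \<delta> t) *\<^sub>R (E_rot *v W t (q t))) (at t within {b..c})"
    if t: "t \<in> {b..c}" for t
  proof -
    have "m (q t) \<bullet> m (q t) = 1" using norm_m[OF qreg[OF t]] by (simp add: norm_eq_1)
    then have "W t (q t) \<bullet> W t (q t) = 1"
      by (simp add: W_def inner_diff_left inner_diff_right flip: power2_eq_square)
    then have "(W t (q t) $ 1)\<^sup>2 + (W t (q t) $ 2)\<^sup>2 = 1"
      by (simp add: inner_real2 power2_eq_square)
    \<comment> \<open>Any angle of the unit vector will do for this fixed \<open>t\<close>, as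
      \<open>desired_rate\<close> depends on the angle only through its heading.\<close>
    then obtain a where "W t (q t) $ 1 = cos a" "W t (q t) $ 2 = sin a"
      using sincos_total_2pi by metis
    then have aW: "W t (q t) = heading a" by (simp add: vec_eq_iff forall_2)
    have m': "((\<lambda>t. m (q t)) has_vector_derivative - R t (q t) *\<^sub>R (E_rot *v m (q t))) (at t within {b..c})"
      using m_along_curve[of q u a t] q(3)[OF t] qreg[OF t] rate[OF qreg[OF t] aW[symmetric]] aW by simp
    have c': "((\<lambda>t. cos (\<delta> t)) has_real_derivative sin (\<delta> t) * (K * \<delta> t)) (at t within {b..c})"
      and s': "((\<lambda>t. sin (\<delta> t)) has_real_derivative - cos (\<delta> t) * (K * \<delta> t)) (at t within {b..c})"
      by (auto intro!: derivative_eq_intros \<delta>_deriv)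
    note has_vector_derivative_diff[OF
      has_vector_derivative_scaleR[OF c' m']
      has_vector_derivative_scaleR[OF s' bounded_linear.has_vector_derivative[OF matrix_vector_mul_bounded_linear[of E_rot] m']]]
    then show ?thesis
      unfolding W_def by (rule has_vector_derivative_eq_rhs) (simp add: vec_eq_iff forall_2 algebra_simps)
  qed
  have heading_\<beta>: "heading (\<beta> t) = W t (q t)" if "t \<in> {b..c}" for t
    by (rule unit_vectors_same_rotation_rate[OF has_vector_derivative_heading[OF \<beta>] W_deriv _ that])
      (simp_all add: \<beta>b q heading_a)

  define x' where "x' t = (if t < b then x t else q t $ 1)" for t
  define y' where "y' t = (if t < b then y t else q t $ 2)" for t
  define \<alpha>' where "\<alpha>' t = (if t < b then \<alpha> t else \<beta> t)" for t
  have pos': "pos x' y' t = (if t < b then r t else q t)" for t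
    by (simp add: pos_def r_def x'_def y'_def vec_eq_iff forall_2)
  have old: "x' t = x t \<and> y' t = y t \<and> \<alpha>' t = \<alpha> t" if "t \<in> time_dom T" for t
    using that T by (simp add: time_dom_def x'_def y'_def \<alpha>'_def)
  have q': "((\<lambda>t. q t $ 1) has_real_derivative u * W t (q t) $ 1) (at t within {b..c})"
    "((\<lambda>t. q t $ 2) has_real_derivative u * W t (q t) $ 2) (at t within {b..c})" if "t \<in> {b..c}" for t
    using q(3)[OF that] by (simp_all add: has_vector_derivative_real2_iff)
  have new: "(x' has_real_derivative u * W t (q t) $ 1) (at t)" "(y' has_real_derivative u * W t (q t) $ 2) (at t)"
    "(\<alpha>' has_real_derivative R t (q t) - K * \<delta> t) (at t)" if t: "b \<le> t" "t < c" for t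
  proof -
    have "(x' has_real_derivative u * W t (q t) $ 1) (at t) \<and> (y' has_real_derivative u * W t (q t) $ 2) (at t) \<and>
      (\<alpha>' has_real_derivative R t (q t) - K * \<delta> t) (at t)"
    proof (cases "t = b")
      \<comment> \<open>At the junction the left derivatives are the limits of the old right-hand
        sides and the right derivatives are those of the new piece; they agree because
        \<open>q b = p\<close>.\<close>
      case True
      have xder: "(x has_real_derivative u * W t (r t) $ 1) (at t)" "(y has_real_derivative u * W t (r t) $ 2) (at t)"
        if "0 < t" "t < b" for t
        using r_deriv[of t] heading_W[of t] that S by (simp_all add: has_vector_derivative_real2_iff)
      have lims: "((\<lambda>t. u * W t (r t) $ 1) \<longlongrightarrow> u * W b p $ 1) (at_left b)"
        "((\<lambda>t. u * W t (r t) $ 2) \<longlongrightarrow> u * W b p $ 2) (at_left b)"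
        "(x \<longlongrightarrow> p $ 1) (at_left b)" "(y \<longlongrightarrow> p $ 2) (at_left b)"
        using tendsto_vec_nth[OF p, of 1] tendsto_vec_nth[OF p, of 2]
        by (auto intro!: tendsto_intros W_lim)
      have bc: "b \<in> {b..c}" using c by simp
      show ?thesis
        unfolding True x'_def[abs_def] y'_def[abs_def] \<alpha>'_def[abs_def]
        using has_real_derivative_glue[OF b c xder(1), of "\<lambda>t. q t $ 1"] lims q'[OF bc] \<beta>[OF bc]
          has_real_derivative_glue[OF b c xder(2), of "\<lambda>t. q t $ 2"]
          has_real_derivative_glue[OF b c \<alpha>_der, of \<beta>] A_lim a
        by (simp add: q(1) \<beta>b)
    next
      case False
      with t have t': "t \<in> {b<..<c}" by simp
      then have tc: "t \<in> {b..c}" by simp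
      have at: "at t within {b..c} = at t" by (rule at_within_Icc_at) (use t' in simp_all)
      have interior: "(f' has_real_derivative D) (at t)"
        if f: "(f has_real_derivative D) (at t within {b..c})" and eq: "\<And>z. z \<in> {b<..<c} \<Longrightarrow> f z = f' z" for f f' D
        using f[unfolded at] by (rule has_field_derivative_transform_within_open[OF _ open_greaterThanLessThan t' eq])
      show ?thesis
        by (intro conjI; rule interior[OF q'(1)[OF tc]] interior[OF q'(2)[OF tc]] interior[OF \<beta>[OF tc]])
          (simp_all add: x'_def y'_def \<alpha>'_def)
    qed
    then show "(x' has_real_derivative u * W t (q t) $ 1) (at t)" "(y' has_real_derivative u * W t (q t) $ 2) (at t)"
      "(\<alpha>' has_real_derivative R t (q t) - K * \<delta> t) (at t)" by auto
  qed
  have "closed_loop_solution \<phi> \<psi> k u K (ereal c) x' y' \<alpha>'"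
    unfolding closed_loop_solution_def
  proof (rule conjI[OF _ ballI])
    show "0 < ereal c" using b c by simp
    fix t assume tc: "t \<in> time_dom (ereal c)"
    consider "t < b" "t \<in> time_dom T" | "b \<le> t" "t < c"
      using tc T by (cases "t < b") (auto simp: time_dom_def)
    then show "n (pos x' y' t) \<noteq> 0 \<and>
      (x' has_real_derivative u * cos (\<alpha>' t)) (at t within time_dom (ereal c)) \<and>
      (y' has_real_derivative u * sin (\<alpha>' t)) (at t within time_dom (ereal c)) \<and>
      (\<alpha>' has_real_derivative desired_rate \<phi> \<psi> k u (pos x' y' t) (\<alpha>' t) -
       K * heading_error \<phi> \<psi> k (pos x' y' t) (\<alpha>' t)) (at t within time_dom (ereal c))"
    proof cases
      case 1
      have at: "at t within time_dom (ereal c) = at t within time_dom T"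
        unfolding T using 1 c by (intro at_within_time_dom_less) auto
      have tr: "(f' has_real_derivative D) (at t within time_dom T)"
        if "(f has_real_derivative D) (at t within time_dom T)" "\<And>z. z \<in> time_dom T \<Longrightarrow> f' z = f z" for f f' D
        unfolding has_field_derivative_def
        by (rule has_derivative_transform[OF 1(2) _ that(1)[unfolded has_field_derivative_def]]) (rule that(2))
      show ?thesis
        using r_regular[OF 1(2)] tr[OF component_derivs(1)[OF 1(2)], of x'] tr[OF component_derivs(2)[OF 1(2)], of y']
          tr[OF component_derivs(3)[OF 1(2)], of \<alpha>'] 1(1) old
        by (simp add: at pos' \<alpha>'_def d_def)
    next
      case 2
      then have t: "t \<in> {b..c}" by simp
      have "heading_error \<phi> \<psi> k (q t) (\<beta> t) = \<delta> t"
        unfolding heading_error_def using 2 \<delta>_range heading_\<beta>[OF t]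
        by (intro directed_angle_eqI norm_m[OF qreg[OF t]] norm_heading) (auto simp: W_def)
      moreover have "W t (q t) $ 1 = cos (\<beta> t)" "W t (q t) $ 2 = sin (\<beta> t)"
        by (simp_all flip: heading_\<beta>[OF t])
      ultimately show ?thesis
        using 2 qreg[OF t] new[OF 2, THEN has_field_derivative_at_within, of "time_dom (ereal c)"]
          rate[OF qreg[OF t] heading_\<beta>[OF t]]
        by (simp add: pos' \<alpha>'_def)
    qed
  qed
  with c old show thesis by (intro that[of c x' y' \<alpha>']) auto
qed

end

section \<open>The alternative for maximal solutions\<close>

theorem theorem1:
  fixes \<phi> :: "real^2 \<Rightarrow> real" and \<psi> :: "real \<Rightarrow> real"
    and k\<^sub>n u\<^sub>r k\<^sub>\<delta> :: real
    and T :: ereal and x y \<alpha> :: "real \<Rightarrow> real"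
  assumes "C2_scalar \<phi>"
    and "\<psi> C1_differentiable_on UNIV" and "strict_mono \<psi>" and "\<psi> 0 = 0"
    and "bdd_above ((\<lambda>u. deriv \<psi> (inv \<psi> u)) ` range \<psi>)"
    and "k\<^sub>n > 0" and "u\<^sub>r > 0" and "k\<^sub>\<delta> > 0"
    and A1: "\<And>\<kappa>::real. \<kappa> > 0 \<Longrightarrow>
      (INF r\<in>{r. edist_to_set r (path_set \<phi>) \<ge> ereal \<kappa>}. ereal \<bar>tracking_error \<phi> \<psi> r\<bar>) > 0"
    and A2: "edist_sets (critical_set \<phi>) (path_set \<phi>) > 0"
    and A3: "\<And>\<kappa>::real. \<kappa> > 0 \<Longrightarrow>
      (INF r\<in>{r. edist_to_set r (critical_set \<phi>) \<ge> ereal \<kappa>}. ereal (norm (grad \<phi> r))) > 0"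
    and A4: "\<exists>\<theta> C. 0 < \<theta> \<and> \<theta> < k\<^sub>\<delta> \<and> C > 0 \<and>
      (\<forall>\<^sub>F r in at_infinity. norm (grad \<phi> r) \<le> C * exp (\<theta> * norm r))"
    and "maximal_closed_loop_solution \<phi> \<psi> k\<^sub>n u\<^sub>r k\<^sub>\<delta> T x y \<alpha>"
  shows "(T = \<infinity> \<and> ((\<lambda>t. edist_to_set (pos x y t) (path_set \<phi>)) \<longlongrightarrow> 0) at_top) \<or>
         ((\<lambda>t. edist_to_set (pos x y t) (critical_set \<phi>)) \<longlongrightarrow> 0) (end_time T)"
proof -
  note max = \<open>maximal_closed_loop_solution \<phi> \<psi> k\<^sub>n u\<^sub>r k\<^sub>\<delta> T x y \<alpha>\<close>
  then have solution: "closed_loop_solution \<phi> \<psi> k\<^sub>n u\<^sub>r k\<^sub>\<delta> T x y \<alpha>"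
    unfolding maximal_closed_loop_solution_def by blast
  interpret guided_robot \<phi> \<psi> k\<^sub>n u\<^sub>r k\<^sub>\<delta> T x y \<alpha>
    by unfold_locales (fact assms solution)+
  have pos_r: "pos x y = r" by (simp add: r_def[abs_def])
  have "T > 0" using sol by (simp add: closed_loop_solution_def)
  then consider "T = \<infinity>" | b where "T = ereal b" by (cases T) auto
  then show ?thesis
  proof cases
    case 1
    then show ?thesis
      using infinite_time_alternative[OF 1 A1 A3] unfolding end_time_def pos_r by simp blast
  next
    case 2
    obtain p where p: "(r \<longlongrightarrow> p) (at_left b)" by (rule finite_time_limit[OF 2])
    \<comment> \<open>A regular limit would permit a prolongation, against maximality. Hence
      \<open>p\<close> is critical, and the distance to \<open>p\<close> bounds the distance to the
      critical set.\<close>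
    have "p \<notin> regular"
    proof
      assume "p \<in> regular"
      from 2 p this show False
      proof (rule extension_past_regular_limit)
        fix c x' y' \<alpha>'
        assume "b < c" "closed_loop_solution \<phi> \<psi> k\<^sub>n u\<^sub>r k\<^sub>\<delta> (ereal c) x' y' \<alpha>'"
          "\<And>t. t \<in> time_dom T \<Longrightarrow> x' t = x t \<and> y' t = y t \<and> \<alpha>' t = \<alpha> t"
        moreover have "T < ereal c" using 2 \<open>b < c\<close> by simp
        ultimately show False
          using max unfolding maximal_closed_loop_solution_def by blast
      qed
    qed
    then have crit: "p \<in> critical_set \<phi>" by (simp add: critical_set_def)
    have "((\<lambda>t. edist_to_set (r t) (critical_set \<phi>)) \<longlongrightarrow> 0) (at_left b)"
    proof (rule edist_tendsto_0I)
      fix \<kappa> :: real assume "\<kappa> > 0"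
      from tendstoD[OF p this]
      show "\<forall>\<^sub>F t in at_left b. edist_to_set (r t) (critical_set \<phi>) < ereal \<kappa>"
        by eventually_elim
          (auto simp: edist_to_set_def intro: le_less_trans[OF INF_lower[OF crit]])
    qed
    then show ?thesis unfolding end_time_def pos_r 2 by simp
  qed
qed

end
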